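(* Let $(X,0)$ be a germ of a closed complex algebraic affine variety of dimension $k$. Then there is a bi-Lipschitz and regular embedding $f:(X,0)\to(\mathbb{C}^{2k},0)$ such that $(f(X),0)$ is a germ of a complex algebraic variety.
   Context: Here $X$ is a closed algebraic subset of some $\mathbb{C}^N$ containing $0$, $k$ is its complex dimension, and sets carry the outer metric, i.e. the restriction of the Euclidean distance of $\mathbb{C}^N\cong\mathbb{R}^{2N}$. A bi-Lipschitz embedding of germs $f:(X,0)\to(\mathbb{C}^n,0)$ is a germ of a map whose image is a germ of a closed set $(Y,0)$ and such that $f:(X,0)\to(Y,0)$ is a germ of a bijection with $f$ and $f^{-1}$ Lipschitz with respect to the outer metrics. Regular is meant in the sense of algebraic geometry (a germ at $0$ of a regular map of algebraic varieties). *)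

theory Defs
  imports "HOL-Analysis.Analysis"
begin

text \<open>Affine space of dimension \<open>n\<close> over the complex numbers. As for the library's
  \<^const>\<open>Euclidean_space\<close>, points are sequences vanishing from index \<open>n\<close> on, so that the
  dimension is a term: the target dimension \<open>2 * k\<close> below depends on the variety and may be 0.\<close>

definition cspace :: "nat \<Rightarrow> (nat \<Rightarrow> complex) set" where
  "cspace n = {x. \<forall>i\<ge>n. x i = 0}"

definition cdist :: "nat \<Rightarrow> (nat \<Rightarrow> complex) \<Rightarrow> (nat \<Rightarrow> complex) \<Rightarrow> real" where
  "cdist n x y = L2_set (\<lambda>i. cmod (x i - y i)) {..<n}"

definition cmetric :: "nat \<Rightarrow> (nat \<Rightarrow> complex) metric" where
  "cmetric n = metric (cspace n, cdist n)"

lemma Metric_space_cspace: "Metric_space (cspace n) (cdist n)"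
proof
  fix x y z
  show "0 \<le> cdist n x y"
    by (simp add: cdist_def)
  show "cdist n x y = cdist n y x"
    by (simp add: cdist_def norm_minus_commute)
  show "cdist n x y = 0 \<longleftrightarrow> x = y" if "x \<in> cspace n" "y \<in> cspace n"
  proof -
    have "cdist n x y = 0 \<longleftrightarrow> (\<forall>i<n. x i = y i)"
      by (auto simp: cdist_def L2_set_eq_0_iff)
    also have "\<dots> \<longleftrightarrow> x = y"
      using that unfolding cspace_def fun_eq_iff mem_Collect_eq by (metis not_less)
    finally show ?thesis .
  qed
  have "cdist n x z \<le> L2_set (\<lambda>i. cmod (x i - y i) + cmod (y i - z i)) {..<n}"
    unfolding cdist_def
    by (rule L2_set_mono) (use dist_triangle[of "x _" "z _" "y _"] in \<open>auto simp: dist_norm\<close>)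
  also have "\<dots> \<le> cdist n x y + cdist n y z"
    unfolding cdist_def by (rule L2_set_triangle_ineq)
  finally show "cdist n x z \<le> cdist n x y + cdist n y z" .
qed

lemma mspace_cmetric [simp]: "mspace (cmetric n) = cspace n"
  by (simp add: cmetric_def Metric_space.mspace_metric Metric_space_cspace)

lemma mdist_cmetric [simp]: "mdist (cmetric n) = cdist n"
  by (simp add: cmetric_def Metric_space.mdist_metric Metric_space_cspace)

abbreviation ctop :: "nat \<Rightarrow> (nat \<Rightarrow> complex) topology" where
  "ctop n \<equiv> mtopology_of (cmetric n)"

text \<open>Polynomials in \<open>n\<close> complex variables, as polynomial functions of the first \<open>n\<close>
  coordinates (compare \<^const>\<open>real_polynomial_function\<close>).\<close>

inductive cpoly :: "nat \<Rightarrow> ((nat \<Rightarrow> complex) \<Rightarrow> complex) \<Rightarrow> bool" for n where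
  const: "cpoly n (\<lambda>_. c)"
| coord: "i < n \<Longrightarrow> cpoly n (\<lambda>x. x i)"
| add: "cpoly n p \<Longrightarrow> cpoly n q \<Longrightarrow> cpoly n (\<lambda>x. p x + q x)"
| mult: "cpoly n p \<Longrightarrow> cpoly n q \<Longrightarrow> cpoly n (\<lambda>x. p x * q x)"

text \<open>The family of equations may be infinite; by Hilbert's basis theorem this is no more general.\<close>

definition algebraic_set :: "nat \<Rightarrow> (nat \<Rightarrow> complex) set \<Rightarrow> bool" where
  "algebraic_set n X \<longleftrightarrow>
     (\<exists>P. (\<forall>p\<in>P. cpoly n p) \<and> X = {x \<in> cspace n. \<forall>p\<in>P. p x = 0})"

definition irreducible_algebraic_set :: "nat \<Rightarrow> (nat \<Rightarrow> complex) set \<Rightarrow> bool" where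
  "irreducible_algebraic_set n Z \<longleftrightarrow> algebraic_set n Z \<and> Z \<noteq> {} \<and>
     (\<forall>A B. algebraic_set n A \<and> algebraic_set n B \<and> Z = A \<union> B \<longrightarrow> A = Z \<or> B = Z)"

text \<open>Complex dimension: supremum of the lengths \<open>d\<close> of strictly increasing chains
  \<open>Z 0 \<subset> \<dots> \<subset> Z d\<close> of irreducible algebraic subsets. (The value at the empty set is 0,
  an irrelevant convention.)\<close>

definition algebraic_dim :: "nat \<Rightarrow> (nat \<Rightarrow> complex) set \<Rightarrow> enat" where
  "algebraic_dim n X =
     (SUP d \<in> {d. \<exists>Z. (\<forall>i\<le>d. irreducible_algebraic_set n (Z i) \<and> Z i \<subseteq> X) \<and>
                      (\<forall>i<d. Z i \<subset> Z (Suc i))}. enat d)"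

text \<open>Regularity of a function at a point: a quotient of polynomials on some Zariski open
  neighbourhood \<open>X - W\<close> of the point in \<open>X\<close>.\<close>

definition regular_at ::
    "nat \<Rightarrow> (nat \<Rightarrow> complex) set \<Rightarrow> ((nat \<Rightarrow> complex) \<Rightarrow> complex) \<Rightarrow> (nat \<Rightarrow> complex) \<Rightarrow> bool" where
  "regular_at n X f a \<longleftrightarrow>
     (\<exists>W p q. algebraic_set n W \<and> a \<in> X - W \<and> cpoly n p \<and> cpoly n q \<and>
              (\<forall>x \<in> X - W. q x \<noteq> 0 \<and> f x = p x / q x))"

abbreviation origin :: "nat \<Rightarrow> complex" where
  "origin \<equiv> \<lambda>_. 0"

text \<open>Here and in \<open>bilipschitz_germ_embedding\<close> the total function \<open>f\<close> represents a germ at the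
  origin of a map on \<open>X\<close>: only its values on \<open>X\<close> near the origin matter.\<close>

definition regular_map_germ ::
    "nat \<Rightarrow> (nat \<Rightarrow> complex) set \<Rightarrow> nat \<Rightarrow> ((nat \<Rightarrow> complex) \<Rightarrow> (nat \<Rightarrow> complex)) \<Rightarrow> bool" where
  "regular_map_germ N X n f \<longleftrightarrow>
     (\<exists>W. algebraic_set N W \<and> origin \<in> X - W \<and>
          (\<forall>x \<in> X - W. f x \<in> cspace n \<and> (\<forall>i<n. regular_at N X (\<lambda>z. f z i) x)))"

definition bilipschitz_on ::
    "nat \<Rightarrow> nat \<Rightarrow> (nat \<Rightarrow> complex) set \<Rightarrow> (nat \<Rightarrow> complex) set \<Rightarrow>
     ((nat \<Rightarrow> complex) \<Rightarrow> (nat \<Rightarrow> complex)) \<Rightarrow> bool" where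
  "bilipschitz_on N n A B f \<longleftrightarrow>
     bij_betw f A B \<and>
     Lipschitz_continuous_map (submetric (cmetric N) A) (submetric (cmetric n) B) f \<and>
     Lipschitz_continuous_map (submetric (cmetric n) B) (submetric (cmetric N) A) (inv_into A f)"

text \<open>The germ \<open>f : (X, 0) \<rightarrow> (C\<^sup>n, 0)\<close> is a bi-Lipschitz embedding (for the outer metrics)
  whose image is the germ at the origin of the closed set \<open>Y\<close>.\<close>

definition bilipschitz_germ_embedding ::
    "nat \<Rightarrow> (nat \<Rightarrow> complex) set \<Rightarrow> nat \<Rightarrow> ((nat \<Rightarrow> complex) \<Rightarrow> (nat \<Rightarrow> complex)) \<Rightarrow>
     (nat \<Rightarrow> complex) set \<Rightarrow> bool" where
  "bilipschitz_germ_embedding N X n f Y \<longleftrightarrow>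
     closedin (ctop n) Y \<and> f origin = origin \<and>
     (\<exists>U V. openin (ctop N) U \<and> origin \<in> U \<and> openin (ctop n) V \<and> origin \<in> V \<and>
            bilipschitz_on N n (X \<inter> U) (Y \<inter> V) f)"

definition same_germ :: "nat \<Rightarrow> (nat \<Rightarrow> complex) set \<Rightarrow> (nat \<Rightarrow> complex) set \<Rightarrow> bool" where
  "same_germ n A B \<longleftrightarrow> (\<exists>V. openin (ctop n) V \<and> origin \<in> V \<and> A \<inter> V = B \<inter> V)"

end

theory Submission
  imports Defs "Subresultants.Subresultant_Gcd" "HOL-Computational_Algebra.Field_as_Ring"
    "HOL-Computational_Algebra.Fundamental_Theorem_Algebra"
begin

text \<open>Noether normalization gives a finite map from \<open>X\<close> onto some affine \<open>m\<close>-space; lifting the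
  chain of coordinate subspaces shows \<open>m \<le> k\<close>, and hence the polynomials of degree at most \<open>D\<close>
  restrict to a space of functions on \<open>X\<close> of dimension \<open>O(D\<^sup>k)\<close>. Counting monomials, if \<open>X\<close> lies in
  affine \<open>n\<close>-space with \<open>n > 2 k\<close> and \<open>k \<ge> 1\<close>, then some nonzero homogeneous polynomial \<open>G\<close> vanishes
  on \<open>X\<close> and some nonzero polynomial \<open>F\<close> vanishes on all differences \<open>x - y\<close> of points of \<open>X\<close>.
  Project along a direction where neither \<open>G\<close> nor the lowest form of \<open>F\<close> vanishes. Because of \<open>G\<close>,
  the projection is finite on \<open>X\<close>, so that its image is algebraic, and \<open>X\<close> meets its kernel only in
  the origin. The lowest form of \<open>F\<close> vanishes on all limits of secants of \<open>X\<close> at the origin, so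
  the projection is bi-Lipschitz there. Such projections are iterated until \<open>n = 2 k\<close>. For \<open>k = 0\<close>,
  the origin is isolated in \<open>X\<close>.\<close>

text \<open>From \<open>algebraic_dim\<close> only an upper bound for the number m of variables in a
  normalization is extracted; counting does the rest. Exponents up to E in n variables give (E +
  1)^n monomials of degree at most n E, and a growth bound of order less than n in the degree makes
  their restrictions dependent once E is large. For F the restrictions live on pairs: a monomial in
  x - y expands into products p x * q y, so the bound is squared to order D^(2 k), and 2 k < n
  suffices. This is the origin of the target dimension. For G one variable is spent on making the
  monomials homogeneous, so k < n - 1 is required. This follows from 2 k < n if k >= 1, but not if k
  = 0: two points on a line, one of them the origin, admit no nonzero form G. Hence the separate
  case. The condition on F controls secants near the origin only, so the projection may well
  identify points of X far away from it.\<close>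

section \<open>Polynomial functions and their degrees\<close>

inductive hpoly :: "nat \<Rightarrow> nat \<Rightarrow> ((nat \<Rightarrow> complex) \<Rightarrow> complex) \<Rightarrow> bool" for n where
  zero: "hpoly n d (\<lambda>_. 0)"
| const: "hpoly n 0 (\<lambda>_. c)"
| var: "i < n \<Longrightarrow> hpoly n d p \<Longrightarrow> hpoly n (Suc d) (\<lambda>x. x i * p x)"
| add: "hpoly n d p \<Longrightarrow> hpoly n d q \<Longrightarrow> hpoly n d (\<lambda>x. p x + q x)"

inductive dpoly :: "nat \<Rightarrow> nat \<Rightarrow> ((nat \<Rightarrow> complex) \<Rightarrow> complex) \<Rightarrow> bool" for n where
  const: "dpoly n d (\<lambda>_. c)"
| var: "i < n \<Longrightarrow> dpoly n d p \<Longrightarrow> dpoly n (Suc d) (\<lambda>x. x i * p x)"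
| add: "dpoly n d p \<Longrightarrow> dpoly n d q \<Longrightarrow> dpoly n d (\<lambda>x. p x + q x)"

lemma dpoly_mono: "dpoly n d p \<Longrightarrow> d \<le> e \<Longrightarrow> dpoly n e p"
proof (induction arbitrary: e rule: dpoly.induct)
  case (var i d p)
  then show ?case by (cases e) (auto intro: dpoly.intros)
qed (auto intro: dpoly.intros)

lemma dpoly_cmult: "dpoly n d p \<Longrightarrow> dpoly n d (\<lambda>x. c * p x)"
proof (induction rule: dpoly.induct)
  case (var i d p)
  from dpoly.var[OF var.hyps(1) var.IH] show ?case by (simp add: mult.left_commute)
next
  case (add d p q)
  from dpoly.add[OF add.IH] show ?case by (simp add: distrib_left)
qed (auto intro: dpoly.intros)

lemma dpoly_mult: "dpoly n d p \<Longrightarrow> dpoly n e q \<Longrightarrow> dpoly n (d + e) (\<lambda>x. p x * q x)"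
proof (induction rule: dpoly.induct)
  case (const d c)
  then show ?case by (metis dpoly_cmult dpoly_mono le_add2)
next
  case (var i d p)
  from dpoly.var[OF var.hyps(1) var.IH[OF var.prems]] show ?case by (simp add: mult.assoc)
next
  case (add d p1 p2)
  from dpoly.add[OF add.IH(1)[OF add.prems] add.IH(2)[OF add.prems]] show ?case
    by (simp add: distrib_right)
qed

lemma dpoly_sum: "(\<And>a. a \<in> A \<Longrightarrow> dpoly n d (f a)) \<Longrightarrow> dpoly n d (\<lambda>x. \<Sum>a\<in>A. f a x)"
  by (induction A rule: infinite_finite_induct) (auto intro: dpoly.intros)

lemma dpoly_coord: "i < n \<Longrightarrow> dpoly n 1 (\<lambda>x. x i)"
  using dpoly.var[OF _ dpoly.const, of i n 0 1] by simp

lemma dpoly_imp_cpoly: "dpoly n d p \<Longrightarrow> cpoly n p"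
  by (induction rule: dpoly.induct) (auto intro: cpoly.intros)

lemma cpoly_imp_dpoly: "cpoly n p \<Longrightarrow> \<exists>d. dpoly n d p"
proof (induction rule: cpoly.induct)
  case (add p q)
  then obtain d e where "dpoly n d p" "dpoly n e q" by auto
  then have "dpoly n (max d e) p" "dpoly n (max d e) q" by (auto elim: dpoly_mono)
  then show ?case using dpoly.add by blast
next
  case (mult p q)
  then show ?case using dpoly_mult by meson
qed (auto intro: dpoly.const dpoly_coord)

section \<open>Substitution, limits and restriction to lines\<close>

lemma dpoly_subst:
  "dpoly n d p \<Longrightarrow> (\<And>i. i < n \<Longrightarrow> dpoly m 1 (\<lambda>x. g x i)) \<Longrightarrow> dpoly m d (\<lambda>x. p (g x))"
proof (induction rule: dpoly.induct)
  case (var i d p)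
  from dpoly_mult[OF var.prems[OF var.hyps(1)] var.IH[OF var.prems]] show ?case by simp
qed (auto intro: dpoly.intros)

lemma cpoly_sum: "(\<And>a. a \<in> A \<Longrightarrow> cpoly n (f a)) \<Longrightarrow> cpoly n (\<lambda>x. \<Sum>a\<in>A. f a x)"
  by (induction A rule: infinite_finite_induct) (auto intro: cpoly.intros)

lemma cpoly_prod: "(\<And>a. a \<in> A \<Longrightarrow> cpoly n (f a)) \<Longrightarrow> cpoly n (\<lambda>x. \<Prod>a\<in>A. f a x)"
  by (induction A rule: infinite_finite_induct) (auto intro: cpoly.intros)

lemma cpoly_subst:
  "cpoly n p \<Longrightarrow> (\<And>i. i < n \<Longrightarrow> cpoly m (\<lambda>x. g x i)) \<Longrightarrow> cpoly m (\<lambda>x. p (g x))"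
  by (induction rule: cpoly.induct) (auto intro: cpoly.intros)

lemma cpoly_mono: "cpoly n p \<Longrightarrow> n \<le> m \<Longrightarrow> cpoly m p"
  by (induction rule: cpoly.induct) (auto intro: cpoly.intros)

lemma cpoly_cong: "cpoly n p \<Longrightarrow> (\<And>i. i < n \<Longrightarrow> x i = y i) \<Longrightarrow> p x = p y"
  by (induction rule: cpoly.induct) auto

lemma cpoly_tendsto:
  "cpoly n p \<Longrightarrow> (\<And>i. i < n \<Longrightarrow> ((\<lambda>k. z k i) \<longlongrightarrow> e i) F) \<Longrightarrow> ((\<lambda>k. p (z k)) \<longlongrightarrow> p e) F"
  by (induction rule: cpoly.induct) (auto intro: tendsto_intros)

lemma cpoly_on_line: "cpoly n p \<Longrightarrow> \<exists>P. \<forall>s. p (\<lambda>i. a i + s * b i) = poly P s"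
proof (induction rule: cpoly.induct)
  case (const c)
  show ?case by (rule exI[of _ "[:c:]"]) simp
next
  case (coord i)
  show ?case by (rule exI[of _ "[:a i, b i:]"]) simp
next
  case (add p q)
  then show ?case by (metis poly_add)
next
  case (mult p q)
  then show ?case by (metis poly_mult)
qed

text \<open>On the line joining a and b both restrictions are nonzero univariate polynomials, as s =
  0 and s = 1 show, so their product has a non-root. The choice of directions and the irreducibility
  of linear spaces rest on this.\<close>

lemma cpoly_common_nonzero:
  assumes "cpoly n p" "cpoly n q" "p a \<noteq> 0" "q b \<noteq> 0"
  obtains s where "p (\<lambda>i. a i + s * (b i - a i)) \<noteq> 0" "q (\<lambda>i. a i + s * (b i - a i)) \<noteq> 0"
proof -
  obtain P where P: "\<And>s. p (\<lambda>i. a i + s * (b i - a i)) = poly P s"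
    using cpoly_on_line[OF assms(1)] by meson
  obtain Q where Q: "\<And>s. q (\<lambda>i. a i + s * (b i - a i)) = poly Q s"
    using cpoly_on_line[OF assms(2)] by meson
  have "P \<noteq> 0" using P[of 0] assms(3) by auto
  moreover have "Q \<noteq> 0" using Q[of 1] assms(4) by auto
  ultimately have "P * Q \<noteq> 0" by simp
  then obtain s where "poly (P * Q) s \<noteq> 0"
    using poly_all_0_iff_0 by blast
  then show ?thesis using that[of s] by (simp add: P Q)
qed

section \<open>Forms and decomposition into homogeneous parts\<close>

lemma hpoly_imp_dpoly: "hpoly n d p \<Longrightarrow> dpoly n d p"
  by (induction rule: hpoly.induct) (auto intro: dpoly.intros)

lemma hpoly_imp_cpoly: "hpoly n d p \<Longrightarrow> cpoly n p"
  by (rule dpoly_imp_cpoly[OF hpoly_imp_dpoly])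

lemma hpoly_scale: "hpoly n d p \<Longrightarrow> p (\<lambda>i. s * x i) = s ^ d * p x"
  by (induction rule: hpoly.induct) (auto simp: algebra_simps)

lemma hpoly_cmult: "hpoly n d p \<Longrightarrow> hpoly n d (\<lambda>x. c * p x)"
proof (induction rule: hpoly.induct)
  case (var i d p)
  from hpoly.var[OF var.hyps(1) var.IH] show ?case by (simp add: mult.left_commute)
next
  case (add d p q)
  from hpoly.add[OF add.IH] show ?case by (simp add: distrib_left)
qed (auto intro: hpoly.intros)

lemma hpoly_sum: "(\<And>a. a \<in> A \<Longrightarrow> hpoly n d (f a)) \<Longrightarrow> hpoly n d (\<lambda>x. \<Sum>a\<in>A. f a x)"
  by (induction A rule: infinite_finite_induct) (auto intro: hpoly.intros)

lemma dpoly_homogeneous_parts: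
  "dpoly n d p \<Longrightarrow> \<exists>h. (\<forall>j. hpoly n j (h j)) \<and> (\<forall>x. p x = (\<Sum>j\<le>d. h j x))"
proof (induction rule: dpoly.induct)
  case (const d c)
  show ?case
    by (rule exI[of _ "\<lambda>j. if j = 0 then (\<lambda>_. c) else (\<lambda>_. 0)"])
       (auto intro: hpoly.intros simp: if_distrib[of "\<lambda>f. f _"] cong: if_cong)
next
  case (var i d p)
  then obtain h where h: "\<And>j. hpoly n j (h j)" "\<And>x. p x = (\<Sum>j\<le>d. h j x)" by auto
  define h' where "h' j = (case j of 0 \<Rightarrow> (\<lambda>_. 0) | Suc l \<Rightarrow> (\<lambda>x. x i * h l x))" for j
  have "hpoly n j (h' j)" for j
    unfolding h'_def using h(1) var.hyps by (cases j) (auto intro: hpoly.intros)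
  moreover have "x i * p x = (\<Sum>j\<le>Suc d. h' j x)" for x
    by (simp add: h'_def sum.atMost_Suc_shift h(2) sum_distrib_left del: sum.atMost_Suc)
  ultimately show ?case by blast
next
  case (add d p q)
  then obtain h h' where "\<And>j. hpoly n j (h j)" "\<And>x. p x = (\<Sum>j\<le>d. h j x)"
    "\<And>j. hpoly n j (h' j)" "\<And>x. q x = (\<Sum>j\<le>d. h' j x)" by auto
  then show ?case
    by (intro exI[of _ "\<lambda>j x. h j x + h' j x"]) (auto intro: hpoly.intros simp: sum.distrib)
qed

section \<open>Parallel lines and the projection along them\<close>

definition lift :: "nat \<Rightarrow> (nat \<Rightarrow> complex) \<Rightarrow> (nat \<Rightarrow> complex) \<Rightarrow> complex \<Rightarrow> nat \<Rightarrow> complex" where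
  "lift n u y t = (\<lambda>j. if j < n then y j + t * u j else if j = n then t else 0)"

text \<open>For fixed y, \<open>lift n u y t\<close> runs through the line that meets the hyperplane
  of last coordinate 0 in y and has direction \<open>lift n u origin 1\<close>, that is (u, 1). The
  map \<open>proj n u\<close> follows this line back to the hyperplane.\<close>

definition proj :: "nat \<Rightarrow> (nat \<Rightarrow> complex) \<Rightarrow> (nat \<Rightarrow> complex) \<Rightarrow> nat \<Rightarrow> complex" where
  "proj n u x = (\<lambda>j. if j < n then x j - x n * u j else 0)"

lemma lift_proj: "x \<in> cspace (Suc n) \<Longrightarrow> lift n u (proj n u x) (x n) = x"
  by (auto simp: lift_def proj_def cspace_def fun_eq_iff)

lemma proj_lift: "y \<in> cspace n \<Longrightarrow> proj n u (lift n u y t) = y"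
  by (auto simp: lift_def proj_def cspace_def fun_eq_iff)

lemma lift_last [simp]: "lift n u y t n = t"
  by (simp add: lift_def)

lemma lift_in_cspace: "lift n u y t \<in> cspace (Suc n)"
  by (auto simp: lift_def cspace_def)

lemma proj_in_cspace: "proj n u x \<in> cspace n"
  by (auto simp: proj_def cspace_def)

text \<open>Along the line, y and t share the total degree d: the coefficient of t^i is left with
  degree d - i in y. For i = d it is free of y, hence equal to its value at y = 0, where p is p (u,
  1) times t^d.\<close>

lemma hpoly_lift:
  "hpoly (Suc n) d p \<Longrightarrow>
    \<exists>B. (\<forall>y t. p (lift n u y t) = poly (B y) t) \<and>
        (\<forall>y. degree (B y) \<le> d \<and> coeff (B y) d = p (lift n u origin 1)) \<and>
        (\<forall>i. dpoly n (d - i) (\<lambda>y. coeff (B y) i))"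
proof (induction rule: hpoly.induct)
  case (zero d)
  show ?case by (rule exI[of _ "\<lambda>_. 0"]) (auto intro: dpoly.intros)
next
  case (const c)
  have "dpoly n 0 (\<lambda>y. coeff [:c:] i)" for i by (rule dpoly.const)
  then show ?case by (intro exI[of _ "\<lambda>_. [:c:]"]) auto
next
  case (var j d p)
  then obtain B where B: "\<And>y t. p (lift n u y t) = poly (B y) t" "\<And>y. degree (B y) \<le> d"
     "\<And>y. coeff (B y) d = p (lift n u origin 1)" "\<And>i. dpoly n (d - i) (\<lambda>y. coeff (B y) i)"
    by blast
  define a where "a y = (if j < n then y j else 0)" for y :: "nat \<Rightarrow> complex"
  define b where "b = (if j < n then u j else 1)"
  have lj: "lift n u y t j = a y + t * b" for y t
    using var.hyps by (auto simp: lift_def a_def b_def)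
  define B' where "B' y = Polynomial.smult (a y) (B y) + pCons 0 (Polynomial.smult b (B y))" for y
  have "dpoly n (Suc d - i) (\<lambda>y. coeff (B' y) i)" for i
  proof -
    have 1: "dpoly n (Suc d - i) (\<lambda>y. a y * coeff (B y) i)"
    proof (cases "i \<le> d \<and> j < n")
      case True
      then show ?thesis using dpoly.var[OF _ B(4)[of i], of j] by (simp add: a_def Suc_diff_le)
    next
      \<comment> \<open>Either j = n, and a y is 0, or i > d, where the subtraction truncates but
        the coefficient is 0.\<close>
      case False
      then have "(\<lambda>y. a y * coeff (B y) i) = (\<lambda>_. 0)"
        using B(2) by (auto simp: a_def fun_eq_iff intro!: coeff_eq_0 le_less_trans[OF B(2)])
      then show ?thesis by (simp only: dpoly.const)
    qed
    have 2: "dpoly n (Suc d - i) (\<lambda>y. coeff (pCons 0 (Polynomial.smult b (B y))) i)"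
      using dpoly_cmult[OF B(4)] by (cases i) (auto intro: dpoly.intros)
    show ?thesis using dpoly.add[OF 1 2] by (simp add: B'_def)
  qed
  moreover have "lift n u y t j * p (lift n u y t) = poly (B' y) t" for y t
    by (simp add: B'_def B(1) lj algebra_simps)
  moreover have "degree (B' y) \<le> Suc d" for y
    unfolding B'_def using B(2)[of y]
    by (intro degree_add_le) (auto intro: order_trans[OF degree_smult_le] order_trans[OF degree_pCons_le])
  moreover have "coeff (B' y) (Suc d) = lift n u origin 1 j * p (lift n u origin 1)" for y
    using B(2)[of y] B(3)[of y] unfolding lj by (simp add: B'_def coeff_eq_0 a_def)
  ultimately show ?case by blast
next
  case (add d p q)
  obtain B where B: "\<And>y t. p (lift n u y t) = poly (B y) t" "\<And>y. degree (B y) \<le> d"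
     "\<And>y. coeff (B y) d = p (lift n u origin 1)" "\<And>i. dpoly n (d - i) (\<lambda>y. coeff (B y) i)"
    using add.IH(1) by blast
  obtain C where C: "\<And>y t. q (lift n u y t) = poly (C y) t" "\<And>y. degree (C y) \<le> d"
     "\<And>y. coeff (C y) d = q (lift n u origin 1)" "\<And>i. dpoly n (d - i) (\<lambda>y. coeff (C y) i)"
    using add.IH(2) by blast
  have "dpoly n (d - i) (\<lambda>y. coeff (B y + C y) i)" for i
    using dpoly.add[OF B(4) C(4)] by simp
  then show ?case
    using B(1-3) C(1-3) by (intro exI[of _ "\<lambda>y. B y + C y"]) (simp add: degree_add_le)
qed

text \<open>Forms of degree below d do not reach t^d, so the leading coefficient is the value of the
  top form at the direction. If it is nonzero, B is monic up to a constant factor, with the same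
  degree over all y: an integral equation for the last coordinate.\<close>

lemma dpoly_lift:
  assumes "\<And>j. hpoly (Suc n) j (h j)"
  shows "\<exists>B. (\<forall>y t. (\<Sum>j\<le>d. h j (lift n u y t)) = poly (B y) t) \<and>
        (\<forall>y. degree (B y) \<le> d \<and> coeff (B y) d = h d (lift n u origin 1)) \<and>
        (\<forall>i. dpoly n d (\<lambda>y. coeff (B y) i))"
proof -
  obtain B where B: "\<And>j y t. h j (lift n u y t) = poly (B j y) t" "\<And>j y. degree (B j y) \<le> j"
     "\<And>j y. coeff (B j y) j = h j (lift n u origin 1)" "\<And>j i. dpoly n (j - i) (\<lambda>y. coeff (B j y) i)"
  proof -
    have "\<forall>j. \<exists>B. (\<forall>y t. h j (lift n u y t) = poly (B y) t) \<and>
        (\<forall>y. degree (B y) \<le> j \<and> coeff (B y) j = h j (lift n u origin 1)) \<and>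
        (\<forall>i. dpoly n (j - i) (\<lambda>y. coeff (B y) i))"
      using hpoly_lift[OF assms] by blast
    from choice[OF this] that show thesis by blast
  qed
  have "coeff (\<Sum>j\<le>d. B j y) d = h d (lift n u origin 1)" for y
  proof -
    have "coeff (\<Sum>j\<le>d. B j y) d = (\<Sum>j\<le>d. if j = d then coeff (B d y) d else 0)"
      unfolding coeff_sum
      by (intro sum.cong refl) (use B(2)[of _ y] in \<open>auto intro!: coeff_eq_0 le_less_trans[OF B(2)]\<close>)
    then show ?thesis by (simp add: B(3))
  qed
  moreover have "degree (\<Sum>j\<le>d. B j y) \<le> d" for y
    by (intro degree_sum_le) (use B(2)[of _ y] in \<open>auto intro: order_trans\<close>)
  moreover have "dpoly n d (\<lambda>y. coeff (\<Sum>j\<le>d. B j y) i)" for i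
    unfolding coeff_sum by (intro dpoly_sum dpoly_mono[OF B(4)]) auto
  moreover have "(\<Sum>j\<le>d. h j (lift n u y t)) = poly (\<Sum>j\<le>d. B j y) t" for y t
    by (simp add: B(1) poly_sum)
  ultimately show ?thesis by (intro exI[of _ "\<lambda>y. \<Sum>j\<le>d. B j y"]) blast
qed

section \<open>Elimination of a variable\<close>

lemma cpoly_if:
  "(b \<Longrightarrow> cpoly n p) \<Longrightarrow> (\<not> b \<Longrightarrow> cpoly n q) \<Longrightarrow> cpoly n (\<lambda>x. if b then p x else q x)"
  by (cases b) simp_all

text \<open>With fixed degrees d and e the Sylvester matrix has a fixed size, and the Leibniz
  expansion of its determinant is a polynomial in the coefficients.\<close>

lemma cpoly_resultant:
  assumes "\<And>i. cpoly n (\<lambda>y. coeff (P y) i)" "\<And>i. cpoly n (\<lambda>y. coeff (Q y) i)"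
    and "\<And>y. degree (P y) = d" "\<And>y. degree (Q y) = e"
  shows "cpoly n (\<lambda>y. resultant (P y) (Q y))"
proof -
  have entry: "cpoly n (\<lambda>y. sylvester_mat_sub d e (P y) (Q y) $$ (i, j))"
    if "i < d + e" "j < d + e" for i j
    using assms(1,2) that
    by (auto simp: sylvester_mat_sub_def intro!: cpoly_if intro: cpoly.const)
  have "resultant (P y) (Q y) = (\<Sum>\<sigma> | \<sigma> permutes {0..<d+e}.
      signof \<sigma> * (\<Prod>i = 0..<d+e. sylvester_mat_sub d e (P y) (Q y) $$ (i, \<sigma> i)))" for y
    unfolding resultant_sub assms(3,4) resultant_sub_def by (subst det_def) simp
  moreover have "cpoly n (\<lambda>y. \<Sum>\<sigma> | \<sigma> permutes {0..<d+e}.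
      signof \<sigma> * (\<Prod>i = 0..<d+e. sylvester_mat_sub d e (P y) (Q y) $$ (i, \<sigma> i)))"
  proof (intro cpoly_sum cpoly.mult cpoly.const cpoly_prod entry)
    fix \<sigma> i assume "\<sigma> \<in> {\<sigma>. \<sigma> permutes {0..<d+e}}" "i \<in> {0..<d+e}"
    then show "i < d + e" "\<sigma> i < d + e" using permutes_in_image[of \<sigma> "{0..<d+e}" i] by auto
  qed
  ultimately show ?thesis by simp
qed

lemma resultant_eq_0_iff_common_root:
  fixes p q :: "complex poly"
  assumes "p \<noteq> 0"
  shows "resultant p q = 0 \<longleftrightarrow> (\<exists>t. poly p t = 0 \<and> poly q t = 0)"
  unfolding resultant_0_gcd
proof
  assume "degree (gcd p q) \<noteq> 0"
  then have "\<not> constant (poly (gcd p q))" by (simp add: constant_degree)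
  then obtain t where "poly (gcd p q) t = 0" using fundamental_theorem_of_algebra by blast
  then have "[:- t, 1:] dvd gcd p q" by (simp add: poly_eq_0_iff_dvd)
  then show "\<exists>t. poly p t = 0 \<and> poly q t = 0"
    by (auto simp: poly_eq_0_iff_dvd)
next
  assume "\<exists>t. poly p t = 0 \<and> poly q t = 0"
  then obtain t where "[:- t, 1:] dvd gcd p q" by (auto simp: poly_eq_0_iff_dvd)
  moreover have "gcd p q \<noteq> 0" using assms by simp
  ultimately have "degree [:- t, 1:] \<le> degree (gcd p q)" by (rule dvd_imp_degree_le)
  then show "degree (gcd p q) \<noteq> 0" by simp
qed

lemma cpoly_lift:
  assumes "cpoly (Suc n) q"
  obtains C e where "\<And>y t. q (lift n u y t) = poly (C y) t" "\<And>y. degree (C y) \<le> e"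
    "\<And>i. cpoly n (\<lambda>y. coeff (C y) i)"
proof -
  obtain d where "dpoly (Suc n) d q" using cpoly_imp_dpoly[OF assms] by blast
  then obtain h where h: "\<And>j. hpoly (Suc n) j (h j)" "\<And>x. q x = (\<Sum>j\<le>d. h j x)"
    using dpoly_homogeneous_parts by blast
  from dpoly_lift[where h = h and d = d and n = n and u = u, OF h(1)] obtain C where
    "\<And>y t. (\<Sum>j\<le>d. h j (lift n u y t)) = poly (C y) t"
    "\<And>y. degree (C y) \<le> d" "\<And>i. dpoly n d (\<lambda>y. coeff (C y) i)" by blast
  note C = this
  show ?thesis
    by (rule that[of C d]) (simp_all add: C(1,2) h(2) dpoly_imp_cpoly[OF C(3)])
qed

text \<open>Adding a multiple of \<open>B y\<close> of high degree to the second argument of the resultant makes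
  the size of the Sylvester matrix independent of \<open>y\<close>.\<close>

lemma cpoly_eliminate:
  assumes B: "\<And>y. B y \<noteq> 0" "\<And>y. degree (B y) = d" "\<And>i. cpoly n (\<lambda>y. coeff (B y) i)"
    and q: "cpoly (Suc n) q"
  obtains R where "cpoly n R"
    "\<And>y. R y = 0 \<longleftrightarrow> (\<exists>t. poly (B y) t = 0 \<and> q (lift n u y t) = 0)"
proof -
  obtain C e where C: "\<And>y t. q (lift n u y t) = poly (C y) t" "\<And>y. degree (C y) \<le> e"
    "\<And>i. cpoly n (\<lambda>y. coeff (C y) i)"
    by (rule cpoly_lift[OF q, of u]) blast
  define Q where "Q y = C y + monom 1 (Suc e) * B y" for y
  have "degree (Q y) = Suc e + d" for y
  proof -
    have "degree (monom 1 (Suc e) * B y) = Suc e + d"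
      using B by (simp add: degree_mult_eq degree_monom_eq)
    moreover have "degree (C y) < Suc e + d" using C(2)[of y] by simp
    ultimately show ?thesis unfolding Q_def by (metis degree_add_eq_right)
  qed
  moreover have "cpoly n (\<lambda>y. coeff (Q y) i)" for i
  proof (cases "i < Suc e")
    case True
    then show ?thesis using C(3) by (simp add: Q_def coeff_monom_mult)
  next
    case False
    then show ?thesis using cpoly.add[OF C(3) B(3)] by (simp add: Q_def coeff_monom_mult)
  qed
  ultimately have "cpoly n (\<lambda>y. resultant (B y) (Q y))"
    using cpoly_resultant[OF B(3) _ B(2)] by blast
  moreover have "resultant (B y) (Q y) = 0 \<longleftrightarrow>
      (\<exists>t. poly (B y) t = 0 \<and> q (lift n u y t) = 0)" for y
    unfolding resultant_eq_0_iff_common_root[OF B(1)] C(1)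
    by (auto simp: Q_def)
  ultimately show ?thesis by (rule that)
qed

text \<open>Elimination takes a single q, which must therefore serve a whole finite fibre. A new
  point b is handled by p + c q, where p is nonzero at b and c avoids finitely many values.\<close>

lemma cpoly_avoid_finite:
  assumes "finite T"
    and "\<And>a. a \<in> T \<Longrightarrow> \<exists>p. cpoly n p \<and> (\<forall>x\<in>Z. p x = 0) \<and> p a \<noteq> 0"
  shows "\<exists>q. cpoly n q \<and> (\<forall>x\<in>Z. q x = 0) \<and> (\<forall>a\<in>T. q a \<noteq> 0)"
  using assms
proof (induction T)
  case empty
  show ?case by (rule exI[of _ "\<lambda>_. 0"]) (auto intro: cpoly.const)
next
  case (insert b T)
  then obtain q where q: "cpoly n q" "\<forall>x\<in>Z. q x = 0" "\<forall>a\<in>T. q a \<noteq> 0" by auto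
  obtain p where p: "cpoly n p" "\<forall>x\<in>Z. p x = 0" "p b \<noteq> 0" using insert.prems by blast
  have "finite (insert 0 ((\<lambda>a. - p a / q a) ` insert b T))" using insert.hyps by simp
  then obtain c where c: "c \<notin> insert 0 ((\<lambda>a. - p a / q a) ` insert b T)"
    using ex_new_if_finite infinite_UNIV_char_0 by blast
  have "p a + c * q a \<noteq> 0" if "a \<in> insert b T" for a
  proof (cases "q a = 0")
    case True
    then have "a = b" using that q(3) by auto
    then show ?thesis using True p(3) by simp
  next
    case False
    have "c \<noteq> - p a / q a" using c that by blast
    moreover have "c = - p a / q a" if "p a + c * q a = 0"
    proof -
      have "c * q a = - p a" using that by (rule eq_neg_iff_add_eq_0[THEN iffD2, OF trans[OF add.commute]])
      then show ?thesis using False by (metis nonzero_eq_divide_eq)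
    qed
    ultimately show ?thesis by blast
  qed
  moreover have "cpoly n (\<lambda>x. p x + c * q x)" using p(1) q(1) by (intro cpoly.intros)
  ultimately show ?case using p(2) q(2) by (intro exI[of _ "\<lambda>x. p x + c * q x"]) auto
qed

text \<open>Over y, points of Z can only sit at the finitely many roots of B y. If none of these
  points lies in Z, some q vanishes on Z and at none of them, and eliminating t from q and B gives a
  polynomial that vanishes on the image but not at y. The constant degree of B prevents points of Z
  from escaping to infinity.\<close>

lemma algebraic_set_proj:
  assumes B: "\<And>y. B y \<noteq> 0" "\<And>y. degree (B y) = d" "\<And>i. cpoly n (\<lambda>y. coeff (B y) i)"
    and Z: "algebraic_set (Suc n) Z" "\<And>x. x \<in> Z \<Longrightarrow> poly (B (proj n u x)) (x n) = 0"
  shows "algebraic_set n (proj n u ` Z)"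
proof -
  define I where "I = {R. cpoly n R \<and> (\<forall>x\<in>Z. R (proj n u x) = 0)}"
  obtain P where P: "\<And>p. p \<in> P \<Longrightarrow> cpoly (Suc n) p"
    "Z = {x \<in> cspace (Suc n). \<forall>p\<in>P. p x = 0}"
    using Z(1) unfolding algebraic_set_def by blast
  have "y \<in> proj n u ` Z" if y: "y \<in> cspace n" "\<forall>R\<in>I. R y = 0" for y
  proof (rule ccontr)
    assume "y \<notin> proj n u ` Z"
    then have nZ: "lift n u y t \<notin> Z" for t
      using proj_lift[OF y(1)] by (metis image_eqI)
    obtain q where q: "cpoly (Suc n) q" "\<forall>x\<in>Z. q x = 0"
      "\<And>t. poly (B y) t = 0 \<Longrightarrow> q (lift n u y t) \<noteq> 0"
    proof -
      have "finite (lift n u y ` {t. poly (B y) t = 0})"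
        using poly_roots_finite[OF B(1)] by simp
      moreover have "\<exists>p. cpoly (Suc n) p \<and> (\<forall>x\<in>Z. p x = 0) \<and> p a \<noteq> 0"
        if "a \<in> lift n u y ` {t. poly (B y) t = 0}" for a
        using that nZ P lift_in_cspace by blast
      ultimately have "\<exists>q. cpoly (Suc n) q \<and> (\<forall>x\<in>Z. q x = 0) \<and>
          (\<forall>a\<in>lift n u y ` {t. poly (B y) t = 0}. q a \<noteq> 0)"
        by (rule cpoly_avoid_finite)
      then show thesis using that by (elim exE conjE) simp
    qed
    obtain R where R: "cpoly n R"
      "\<And>y. R y = 0 \<longleftrightarrow> (\<exists>t. poly (B y) t = 0 \<and> q (lift n u y t) = 0)"
      using cpoly_eliminate[OF B q(1), of u] by blast
    have "R (proj n u x) = 0" if "x \<in> Z" for x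
    proof -
      have "lift n u (proj n u x) (x n) = x" using that P(2) by (simp add: lift_proj)
      then show ?thesis using R(2) Z(2)[OF that] q(2) that by metis
    qed
    then have "R y = 0" using y(2) R(1) by (simp add: I_def)
    then show False using R(2) q(3) by blast
  qed
  then have "proj n u ` Z = {y \<in> cspace n. \<forall>R\<in>I. R y = 0}"
    using proj_in_cspace by (auto simp: I_def)
  then show ?thesis unfolding algebraic_set_def by (intro exI[of _ I]) (auto simp: I_def)
qed

section \<open>Finite maps and chains of irreducible sets\<close>

text \<open>A geometric substitute for integrality of coordinate rings: closed images and finite
  fibres. Images of all algebraic subsets are included, so that the notion passes to compositions
  and subsets.\<close>

definition finite_map ::
    "nat \<Rightarrow> (nat \<Rightarrow> complex) set \<Rightarrow> nat \<Rightarrow> ((nat \<Rightarrow> complex) \<Rightarrow> nat \<Rightarrow> complex) \<Rightarrow> bool" where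
  "finite_map n X m g \<longleftrightarrow>
     (\<forall>i<m. cpoly n (\<lambda>x. g x i)) \<and> (\<forall>x\<in>X. g x \<in> cspace m) \<and>
     (\<forall>Z. algebraic_set n Z \<and> Z \<subseteq> X \<longrightarrow> algebraic_set m (g ` Z)) \<and>
     (\<forall>y. finite {x \<in> X. g x = y})"

lemma finite_map_compose:
  assumes g: "finite_map n X m g" and h: "finite_map m (g ` X) l h"
  shows "finite_map n X l (\<lambda>x. h (g x))"
proof -
  have "cpoly n (\<lambda>x. h (g x) i)" if "i < l" for i
    using cpoly_subst[of m "\<lambda>y. h y i" n g] g h that by (simp add: finite_map_def)
  moreover have "algebraic_set l ((\<lambda>x. h (g x)) ` Z)" if "algebraic_set n Z" "Z \<subseteq> X" for Z
  proof -
    have "algebraic_set m (g ` Z)" "g ` Z \<subseteq> g ` X" using g that by (auto simp: finite_map_def)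
    then have "algebraic_set l (h ` g ` Z)" using h by (simp add: finite_map_def)
    then show ?thesis by (simp add: image_image)
  qed
  moreover have "finite {x \<in> X. h (g x) = y}" for y
  proof -
    have "{x \<in> X. h (g x) = y} = (\<Union>z\<in>{z \<in> g ` X. h z = y}. {x \<in> X. g x = z})" by auto
    then show ?thesis using g h by (simp add: finite_map_def)
  qed
  ultimately show ?thesis using g h by (simp add: finite_map_def)
qed

lemma finite_map_id:
  assumes "X \<subseteq> cspace n"
  shows "finite_map n X n (\<lambda>x. x)"
proof -
  have "finite {x \<in> X. x = y}" for y by (rule finite_subset[of _ "{y}"]) auto
  then show ?thesis using assms by (auto simp: finite_map_def intro: cpoly.coord)
qed

lemma finite_map_subset:
  assumes "finite_map n X m g" "Z \<subseteq> X"
  shows "finite_map n Z m g"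
proof -
  have "finite {x \<in> Z. g x = y}" for y
  proof (rule finite_subset)
    show "{x \<in> Z. g x = y} \<subseteq> {x \<in> X. g x = y}" using assms(2) by auto
    show "finite {x \<in> X. g x = y}" using assms(1) by (simp add: finite_map_def)
  qed
  then show ?thesis using assms by (simp add: finite_map_def subset_iff)
qed

section \<open>Intersections and preimages of algebraic sets; linear spaces\<close>

lemma algebraic_set_separate:
  assumes "algebraic_set n A" "a \<in> cspace n" "a \<notin> A"
  obtains p where "cpoly n p" "\<forall>x\<in>A. p x = 0" "p a \<noteq> 0"
proof -
  obtain Q where Q: "\<forall>p\<in>Q. cpoly n p" "A = {x \<in> cspace n. \<forall>p\<in>Q. p x = 0}"
    using assms(1) unfolding algebraic_set_def by auto
  then obtain p where "p \<in> Q" "p a \<noteq> 0" using assms(2,3) by auto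
  then show ?thesis using Q by (intro that[of p]) auto
qed

lemma algebraic_set_subset: "algebraic_set n X \<Longrightarrow> X \<subseteq> cspace n"
  by (auto simp: algebraic_set_def)

lemma algebraic_set_Inter:
  assumes "\<And>Z. Z \<in> \<Z> \<Longrightarrow> algebraic_set n Z" "\<Z> \<noteq> {}"
  shows "algebraic_set n (\<Inter>\<Z>)"
proof -
  \<comment> \<open>All polynomials vanishing on some member are collected, which avoids choosing a
    defining family for each member.\<close>
  define P where "P = {p. cpoly n p \<and> (\<exists>Z\<in>\<Z>. \<forall>x\<in>Z. p x = 0)}"
  have "x \<in> \<Inter>\<Z>" if x: "x \<in> cspace n" "\<forall>p\<in>P. p x = 0" for x
  proof
    fix Z assume Z: "Z \<in> \<Z>"
    then obtain Q where Q: "\<forall>p\<in>Q. cpoly n p" "Z = {x \<in> cspace n. \<forall>p\<in>Q. p x = 0}"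
      using assms(1) unfolding algebraic_set_def by blast
    then have "\<forall>x\<in>Z. p x = 0" if "p \<in> Q" for p using that by simp
    then have "Q \<subseteq> P" using Z Q(1) by (auto simp: P_def)
    then show "x \<in> Z" using Q(2) x by auto
  qed
  moreover have "x \<in> cspace n" "\<forall>p\<in>P. p x = 0" if "x \<in> \<Inter>\<Z>" for x
    using that assms(2) algebraic_set_subset[OF assms(1)] by (auto simp: P_def)
  ultimately have "\<Inter>\<Z> = {x \<in> cspace n. \<forall>p\<in>P. p x = 0}" by blast
  then show ?thesis unfolding algebraic_set_def by (intro exI[of _ P]) (auto simp: P_def)
qed

lemma algebraic_set_Int: "algebraic_set n A \<Longrightarrow> algebraic_set n B \<Longrightarrow> algebraic_set n (A \<inter> B)"
  using algebraic_set_Inter[of "{A, B}" n] by auto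

lemma algebraic_set_vimage:
  assumes "finite_map n X m g" "algebraic_set n X" "algebraic_set m F"
  shows "algebraic_set n {x \<in> X. g x \<in> F}"
proof -
  obtain Q where Q: "\<forall>p\<in>Q. cpoly m p" "F = {x \<in> cspace m. \<forall>p\<in>Q. p x = 0}"
    using assms(3) unfolding algebraic_set_def by blast
  have pull: "cpoly n (\<lambda>x. q (g x))" if "q \<in> Q" for q
    using cpoly_subst[of m q n g] Q(1) assms(1) that by (simp add: finite_map_def)
  have "algebraic_set n {x \<in> cspace n. \<forall>p\<in>(\<lambda>q x. q (g x)) ` Q. p x = 0}"
    unfolding algebraic_set_def using pull by (intro exI[of _ "(\<lambda>q x. q (g x)) ` Q"]) auto
  from algebraic_set_Int[OF assms(2) this] show ?thesis
  proof (rule back_subst[of "algebraic_set n"])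
    show "X \<inter> {x \<in> cspace n. \<forall>p\<in>(\<lambda>q x. q (g x)) ` Q. p x = 0} = {x \<in> X. g x \<in> F}"
      using algebraic_set_subset[OF assms(2)] assms(1) by (auto simp: Q(2) finite_map_def)
  qed
qed

lemma algebraic_set_cspace:
  assumes "i \<le> m"
  shows "algebraic_set m (cspace i)"
proof -
  have "cspace i = {x \<in> cspace m. \<forall>p\<in>(\<lambda>j x. x j) ` {i..<m}. p x = 0}"
    using assms by (force simp: cspace_def)
  then show ?thesis unfolding algebraic_set_def
    by (intro exI[of _ "(\<lambda>j x. x j) ` {i..<m}"]) (auto intro: cpoly.coord)
qed

text \<open>If p vanishes on A but not at a, and q on B but not at b, the line through a and b stays
  in the linear space and contains a point where neither vanishes. It lies in neither A nor
  B.\<close>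

lemma irreducible_cspace:
  assumes "i \<le> m"
  shows "irreducible_algebraic_set m (cspace i)"
  unfolding irreducible_algebraic_set_def
proof (intro conjI allI impI)
  show "algebraic_set m (cspace i)" using assms by (rule algebraic_set_cspace)
  show "cspace i \<noteq> {}" by (auto simp: cspace_def)
  fix A B assume AB: "algebraic_set m A \<and> algebraic_set m B \<and> cspace i = A \<union> B"
  show "A = cspace i \<or> B = cspace i"
  proof (rule ccontr)
    assume "\<not> (A = cspace i \<or> B = cspace i)"
    then obtain a b where ab: "a \<in> cspace i" "a \<notin> A" "b \<in> cspace i" "b \<notin> B" using AB by blast
    have "cspace i \<subseteq> cspace m" using assms by (auto simp: cspace_def)
    then have "a \<in> cspace m" "b \<in> cspace m" using ab by auto
    obtain p where p: "cpoly m p" "\<forall>x\<in>A. p x = 0" "p a \<noteq> 0"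
      using algebraic_set_separate[OF _ \<open>a \<in> cspace m\<close> ab(2)] AB by auto
    obtain q where q: "cpoly m q" "\<forall>x\<in>B. q x = 0" "q b \<noteq> 0"
      using algebraic_set_separate[OF _ \<open>b \<in> cspace m\<close> ab(4)] AB by auto
    obtain s where s: "p (\<lambda>i. a i + s * (b i - a i)) \<noteq> 0" "q (\<lambda>i. a i + s * (b i - a i)) \<noteq> 0"
      using cpoly_common_nonzero[OF p(1) q(1) p(3) q(3)] by blast
    have "(\<lambda>i. a i + s * (b i - a i)) \<in> A \<union> B"
      using ab AB by (auto simp: cspace_def)
    then show False using s p(2) q(2) by auto
  qed
qed

text \<open>An algebraic set that is minimal among those mapped onto an irreducible set is irreducible;
  minimal ones exist by Zorn's lemma, because the fibres are finite.\<close>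

lemma ex_irreducible_over:
  assumes g: "finite_map n X m g" and Z: "algebraic_set n Z" "Z \<subseteq> X"
    and F: "irreducible_algebraic_set m F" "F \<subseteq> g ` Z"
  shows "\<exists>W\<subseteq>Z. irreducible_algebraic_set n W \<and> g ` W = F"
proof -
  \<comment> \<open>Members are the removed parts, because Zorn's lemma yields maximal elements: a
    maximal removed part leaves a minimal algebraic set over F.\<close>
  define \<A> where "\<A> = {A. A \<subseteq> Z \<and> algebraic_set n (Z - A) \<and> g ` (Z - A) = F}"
  have F': "algebraic_set m F" using F(1) by (simp add: irreducible_algebraic_set_def)
  have gZ: "finite_map n Z m g"
    using finite_map_subset[OF g Z(2)] .
  have "Z - {x \<in> Z. g x \<notin> F} = {x \<in> Z. g x \<in> F}" by auto
  then have "{x \<in> Z. g x \<notin> F} \<in> \<A>"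
    using algebraic_set_vimage[OF gZ Z(1) F'] F(2) by (auto simp: \<A>_def)
  then have "\<A> \<noteq> {}" by blast
  moreover have "\<Union>\<C> \<in> \<A>" if ne: "\<C> \<noteq> {}" and chain: "subset.chain \<A> \<C>" for \<C>
  proof -
    have C: "\<C> \<subseteq> \<A>" using chain unfolding subset_chain_def by auto
    have eq: "Z - \<Union>\<C> = \<Inter>((\<lambda>A. Z - A) ` \<C>)" using ne by auto
    have "algebraic_set n (Z - \<Union>\<C>)"
      unfolding eq using C ne by (intro algebraic_set_Inter) (auto simp: \<A>_def)
    moreover have "y \<in> g ` (Z - \<Union>\<C>)" if y: "y \<in> F" for y
    proof (rule ccontr)
      assume "y \<notin> g ` (Z - \<Union>\<C>)"
      then have sub: "{x \<in> Z. g x = y} \<subseteq> \<Union>\<C>" by auto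
      have fin: "finite {x \<in> Z. g x = y}" using gZ by (simp add: finite_map_def)
      obtain A where A: "A \<in> \<C>" "{x \<in> Z. g x = y} \<subseteq> A"
        by (rule finite_subset_Union_chain[OF fin sub ne chain])
      then have "y \<notin> g ` (Z - A)" by auto
      then show False using A(1) C y by (auto simp: \<A>_def)
    qed
    moreover have "g ` (Z - \<Union>\<C>) \<subseteq> F" using C ne by (auto simp: \<A>_def)
    ultimately show ?thesis using C by (auto simp: \<A>_def)
  qed
  ultimately have "\<exists>M\<in>\<A>. \<forall>A\<in>\<A>. M \<subseteq> A \<longrightarrow> A = M" by (rule subset_Zorn_nonempty)
  then obtain M where M: "M \<in> \<A>" "\<And>A. A \<in> \<A> \<Longrightarrow> M \<subseteq> A \<Longrightarrow> A = M" by blast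
  define W where "W = Z - M"
  have W: "W \<subseteq> Z" "algebraic_set n W" "g ` W = F" using M(1) by (auto simp: W_def \<A>_def)
  have min: "W' = W" if "algebraic_set n W'" "W' \<subseteq> W" "g ` W' = F" for W'
  proof -
    have "Z - (Z - W') = W'" using that(2) W(1) by auto
    then have "Z - W' \<in> \<A>" using that by (auto simp: \<A>_def)
    moreover have "M \<subseteq> Z - W'" using that(2) M(1) by (auto simp: W_def \<A>_def)
    ultimately have "Z - W' = M" by (rule M(2))
    then show ?thesis using \<open>Z - (Z - W') = W'\<close> by (simp add: W_def)
  qed
  have "A = W \<or> B = W" if AB: "algebraic_set n A" "algebraic_set n B" "W = A \<union> B" for A B
  proof -
    \<comment> \<open>Closed images carry the decomposition of W over to F. Irreducibility of F then
      makes one piece map onto F, and minimality of W identifies this piece with W.\<close>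
    have "algebraic_set m (g ` A)" "algebraic_set m (g ` B)"
      using g AB W(1) Z(2) by (auto simp: finite_map_def)
    moreover have "F = g ` A \<union> g ` B" using W(3) AB(3) by (auto simp: image_Un)
    ultimately have "g ` A = F \<or> g ` B = F"
      using F(1) unfolding irreducible_algebraic_set_def by blast
    then show ?thesis using min[OF AB(1)] min[OF AB(2)] AB(3) by auto
  qed
  moreover have "W \<noteq> {}" using W(3) F(1) by (auto simp: irreducible_algebraic_set_def)
  ultimately have "irreducible_algebraic_set n W"
    using W(2) unfolding irreducible_algebraic_set_def by simp
  then show ?thesis using W by (intro exI[of _ W]) simp
qed

text \<open>The chain is built from the top: an irreducible V over \<open>cspace (Suc j)\<close> has
  an image containing \<open>cspace j\<close>, so the rest is found inside V. Inclusions are strict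
  because the images differ.\<close>

lemma ex_chain_over:
  assumes g: "finite_map n X m g" and Z: "algebraic_set n Z" "Z \<subseteq> X"
    and j: "j \<le> m" "cspace j \<subseteq> g ` Z"
  shows "\<exists>W. (\<forall>i\<le>j. irreducible_algebraic_set n (W i) \<and> W i \<subseteq> Z \<and> g ` W i = cspace i) \<and>
             (\<forall>i<j. W i \<subset> W (Suc i))"
  using Z j
proof (induction j arbitrary: Z)
  case 0
  obtain W where "W \<subseteq> Z" "irreducible_algebraic_set n W" "g ` W = cspace 0"
    using ex_irreducible_over[OF g 0(1,2) irreducible_cspace 0(4)] by auto
  then show ?case by (intro exI[of _ "\<lambda>_. W"]) auto
next
  case (Suc j)
  obtain V where V: "V \<subseteq> Z" "irreducible_algebraic_set n V" "g ` V = cspace (Suc j)"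
    using ex_irreducible_over[OF g Suc.prems(1,2) irreducible_cspace Suc.prems(4)] Suc.prems(3)
    by blast
  have sub: "cspace j \<subset> cspace (Suc j)"
  proof
    show "cspace j \<subseteq> cspace (Suc j)" by (auto simp: cspace_def)
    have "(\<lambda>i. if i = j then 1 else 0) \<in> cspace (Suc j) - cspace j" by (auto simp: cspace_def)
    then show "cspace j \<noteq> cspace (Suc j)" by blast
  qed
  obtain W where W: "\<forall>i\<le>j. irreducible_algebraic_set n (W i) \<and> W i \<subseteq> V \<and> g ` W i = cspace i"
      "\<forall>i<j. W i \<subset> W (Suc i)"
  proof -
    have "algebraic_set n V" "V \<subseteq> X" "j \<le> m" "cspace j \<subseteq> g ` V"
      using V Suc.prems(2,3) sub by (auto simp: irreducible_algebraic_set_def)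
    from Suc.IH[OF this] that show thesis by meson
  qed
  have "W i \<subseteq> Z" if "i \<le> j" for i using W(1) V(1) that by blast
  moreover have "W j \<subset> V" using W(1) V(3) sub by auto
  ultimately show ?case
    using W V by (intro exI[of _ "\<lambda>i. if i \<le> j then W i else V"]) (auto simp: le_Suc_eq less_Suc_eq)
qed

lemma algebraic_dim_ge:
  assumes "finite_map n X m g" "algebraic_set n X" "g ` X = cspace m"
  shows "enat m \<le> algebraic_dim n X"
proof -
  obtain W where "\<forall>i\<le>m. irreducible_algebraic_set n (W i) \<and> W i \<subseteq> X \<and> g ` W i = cspace i"
      "\<forall>i<m. W i \<subset> W (Suc i)"
    using ex_chain_over[OF assms(1,2) subset_refl order_refl] assms(3) by auto
  then show ?thesis unfolding algebraic_dim_def by (intro SUP_upper CollectI exI[of _ W]) simp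
qed

section \<open>Noether normalization and growth of the Hilbert function\<close>

text \<open>A point where both forms and the last coordinate are nonzero is found by moving along a
  line twice. Scaling it to last coordinate 1 keeps the forms nonzero by homogeneity.\<close>

lemma ex_direction:
  assumes "hpoly (Suc n) d p" "hpoly (Suc n) e q" "p a \<noteq> 0" "q b \<noteq> 0"
  shows "\<exists>u. p (lift n u origin 1) \<noteq> 0 \<and> q (lift n u origin 1) \<noteq> 0"
proof -
  have p: "cpoly (Suc n) p" and q: "cpoly (Suc n) q"
    using assms(1,2) by (auto dest: hpoly_imp_cpoly)
  obtain s where s: "p (\<lambda>i. a i + s * (b i - a i)) \<noteq> 0" "q (\<lambda>i. a i + s * (b i - a i)) \<noteq> 0"
    using cpoly_common_nonzero[OF p q assms(3,4)] by blast
  define w where "w = (\<lambda>i. a i + s * (b i - a i))"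
  have "cpoly (Suc n) (\<lambda>x. p x * q x)" "cpoly (Suc n) (\<lambda>x. x n)"
    using p q by (auto intro: cpoly.intros)
  moreover have "p w * q w \<noteq> 0" "(\<lambda>_. 1 :: complex) n \<noteq> 0" using s by (auto simp: w_def)
  ultimately obtain v where v: "p v * q v \<noteq> 0" "v n \<noteq> 0"
    using cpoly_common_nonzero[of "Suc n" "\<lambda>x. p x * q x" "\<lambda>x. x n" w "\<lambda>_. 1"] by blast
  define u where "u j = v j / v n" for j
  have eq: "f (lift n u origin 1) = (1 / v n) ^ c * f v" if "hpoly (Suc n) c f" for f c
  proof -
    have "f (lift n u origin 1) = f (\<lambda>i. (1 / v n) * v i)"
      using v(2) by (intro cpoly_cong[OF hpoly_imp_cpoly[OF that]]) (auto simp: lift_def u_def less_Suc_eq)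
    then show ?thesis using hpoly_scale[OF that, of "1 / v n" v] by simp
  qed
  show ?thesis using v eq[OF assms(1)] eq[OF assms(2)] by (intro exI[of _ u]) auto
qed

lemma dpoly_proj: "i < n \<Longrightarrow> dpoly (Suc n) 1 (\<lambda>x. proj n u x i)"
proof -
  assume i: "i < n"
  have "dpoly (Suc n) 1 (\<lambda>x. x i + (- u i) * x n)"
    using i by (intro dpoly.add dpoly_cmult dpoly_coord) auto
  then show ?thesis using i by (simp add: proj_def mult.commute)
qed

text \<open>The direction is no zero of the form of degree d, so the last coordinate of each point
  of X is a root of a polynomial with constant leading coefficient, as
  \<open>algebraic_set_proj\<close> requires.\<close>

lemma finite_map_proj:
  assumes h: "\<And>j. hpoly (Suc n) j (h j)" and X: "algebraic_set (Suc n) X"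
    and 0: "\<And>x. x \<in> X \<Longrightarrow> (\<Sum>j\<le>d. h j x) = 0" and u: "h d (lift n u origin 1) \<noteq> 0"
  shows "finite_map (Suc n) X n (proj n u)"
proof -
  obtain B where B: "\<And>y t. (\<Sum>j\<le>d. h j (lift n u y t)) = poly (B y) t"
     "\<And>y. degree (B y) \<le> d \<and> coeff (B y) d = h d (lift n u origin 1)"
     "\<And>i. dpoly n d (\<lambda>y. coeff (B y) i)"
    using dpoly_lift[where h = h and n = n and u = u and d = d, OF h] by blast
  have B0: "B y \<noteq> 0" "degree (B y) = d" for y
    using B(2)[of y] u le_degree[of "B y" d] by auto
  have root: "poly (B (proj n u x)) (x n) = 0" if "x \<in> X" for x
  proof -
    have "lift n u (proj n u x) (x n) = x"
      using algebraic_set_subset[OF X] that by (auto intro: lift_proj)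
    then show ?thesis using B(1)[of "proj n u x" "x n"] 0[OF that] by simp
  qed
  have "finite {x \<in> X. proj n u x = y}" for y
  proof (rule finite_subset)
    show "{x \<in> X. proj n u x = y} \<subseteq> lift n u y ` {t. poly (B y) t = 0}"
    proof
      fix x assume "x \<in> {x \<in> X. proj n u x = y}"
      then have x: "x \<in> X" "proj n u x = y" by auto
      then have "x = lift n u y (x n)"
        using algebraic_set_subset[OF X] lift_proj[of x n u] by auto
      then show "x \<in> lift n u y ` {t. poly (B y) t = 0}" using root[OF x(1)] x(2) by blast
    qed
    show "finite (lift n u y ` {t. poly (B y) t = 0})" using poly_roots_finite[OF B0(1)] by simp
  qed
  moreover have "algebraic_set n (proj n u ` Z)" if "algebraic_set (Suc n) Z" "Z \<subseteq> X" for Z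
    using that root by (intro algebraic_set_proj[OF B0 dpoly_imp_cpoly[OF B(3)]]) auto
  moreover have "cpoly (Suc n) (\<lambda>x. proj n u x i)" if "i < n" for i
    using dpoly_imp_cpoly[OF dpoly_proj[OF that]] .
  ultimately show ?thesis unfolding finite_map_def using proj_in_cspace by simp
qed

text \<open>An upper bound M for the dimension of the restrictions of F to X. The spanning functions
  are arbitrary, so that they can be transported along non-polynomial maps.\<close>

definition spanned ::
    "'a set \<Rightarrow> nat \<Rightarrow> ('a \<Rightarrow> complex) set \<Rightarrow> bool" where
  "spanned X M F \<longleftrightarrow> (\<exists>b. \<forall>p\<in>F. \<exists>c. \<forall>x\<in>X. p x = (\<Sum>i<M. c i * b i x))"

lemma spannedI:
  assumes J: "finite J" "card J \<le> M"
    and F: "\<And>p. p \<in> F \<Longrightarrow> \<exists>c. \<forall>x\<in>X. p x = (\<Sum>j\<in>J. c j * b j x)"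
  shows "spanned X M F"
proof -
  obtain e where e: "bij_betw e {..<card J} J"
    using ex_bij_betw_nat_finite[OF J(1)] by (auto simp: atLeast0LessThan)
  have "\<exists>c. \<forall>x\<in>X. p x = (\<Sum>i<M. c i * b (e i) x)" if "p \<in> F" for p
  proof -
    obtain c where c: "\<And>x. x \<in> X \<Longrightarrow> p x = (\<Sum>j\<in>J. c j * b j x)" using F[OF \<open>p \<in> F\<close>] by auto
    have "p x = (\<Sum>i<M. (if i < card J then c (e i) else 0) * b (e i) x)" if "x \<in> X" for x
    proof -
      have "(\<Sum>i<M. (if i < card J then c (e i) else 0) * b (e i) x)
          = (\<Sum>i<card J. c (e i) * b (e i) x)"
        using J(2) by (intro sum.mono_neutral_cong_right) auto
      also have "\<dots> = (\<Sum>j\<in>J. c j * b j x)" by (rule sum.reindex_bij_betw[OF e])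
      finally show ?thesis using c[OF that] by simp
    qed
    then show ?thesis by (intro exI[of _ "\<lambda>i. if i < card J then c (e i) else 0"]) simp
  qed
  then show ?thesis unfolding spanned_def by (intro exI[of _ "\<lambda>i. b (e i)"]) simp
qed

lemma spanned_mono: "spanned X M F \<Longrightarrow> M \<le> M' \<Longrightarrow> spanned X M' F"
proof -
  assume "spanned X M F" and le: "M \<le> M'"
  then obtain b where b: "\<forall>p\<in>F. \<exists>c. \<forall>x\<in>X. p x = (\<Sum>i<M. c i * b i x)"
    unfolding spanned_def by auto
  show ?thesis by (rule spannedI[of "{..<M}", where b = b]) (use le b in auto)
qed

text \<open>The growth of the Hilbert function of \<open>X\<close> is a substitute for the dimension that is inherited by
  images under linear maps.\<close>

definition growth :: "nat \<Rightarrow> (nat \<Rightarrow> complex) set \<Rightarrow> nat \<Rightarrow> bool" where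
  "growth n X k \<longleftrightarrow> (\<exists>C. \<forall>D. spanned X (C * (D + 1) ^ k) {p. dpoly n D p})"

lemma growth_mono:
  assumes "growth n X k" "k \<le> l"
  shows "growth n X l"
proof -
  obtain C where C: "\<And>D. spanned X (C * (D + 1) ^ k) {p. dpoly n D p}"
    using assms(1) by (auto simp: growth_def)
  have "spanned X (C * (D + 1) ^ l) {p. dpoly n D p}" for D
    using assms(2) by (intro spanned_mono[OF C] mult_le_mono2 power_increasing) auto
  then show ?thesis by (auto simp: growth_def)
qed

text \<open>Substituting functions of degree 1 does not raise the degree, so both k and C are
  kept.\<close>

lemma growth_image:
  assumes "growth n X k" and g: "\<And>i. i < m \<Longrightarrow> dpoly n 1 (\<lambda>x. g x i)"
  shows "growth m (g ` X) k"
proof -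
  obtain C where C: "\<And>D. spanned X (C * (D + 1) ^ k) {p. dpoly n D p}"
    using assms(1) by (auto simp: growth_def)
  have "spanned (g ` X) (C * (D + 1) ^ k) {p. dpoly m D p}" for D
  proof -
    obtain b where b: "\<And>p. dpoly n D p \<Longrightarrow> \<exists>c. \<forall>x\<in>X. p x = (\<Sum>i<C * (D + 1) ^ k. c i * b i x)"
      using C[of D] by (auto simp: spanned_def)
    \<comment> \<open>A spanning function is moved to the image by choosing a preimage x of y; p y =
      p (g x) holds for every choice.\<close>
    have "\<exists>c. \<forall>y\<in>g ` X. p y = (\<Sum>i<C * (D + 1) ^ k. c i * b i (inv_into X g y))"
      if "dpoly m D p" for p
    proof -
      have sub: "dpoly n D (\<lambda>x. p (g x))" using dpoly_subst[OF that g] .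
      obtain c where c: "\<And>x. x \<in> X \<Longrightarrow> p (g x) = (\<Sum>i<C * (D + 1) ^ k. c i * b i x)"
        using b[OF sub] by auto
      have "p y = (\<Sum>i<C * (D + 1) ^ k. c i * b i (inv_into X g y))" if "y \<in> g ` X" for y
        using c[of "inv_into X g y"] that by (simp add: inv_into_into f_inv_into_f)
      then show ?thesis by blast
    qed
    then show ?thesis unfolding spanned_def by (intro exI[of _ "\<lambda>i y. b i (inv_into X g y)"]) simp
  qed
  then show ?thesis by (auto simp: growth_def)
qed

text \<open>Spanning functions are products of a power of the last coordinate, with exponent below
  L, and a spanning function of Y pulled back by g.\<close>

lemma spanned_proj:
  assumes Y: "spanned Y M {p. dpoly n E p}" "\<And>x. x \<in> X \<Longrightarrow> g x \<in> Y"
    and F: "\<And>q. q \<in> F \<Longrightarrow>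
      \<exists>c. (\<forall>l<L. dpoly n E (c l)) \<and> (\<forall>x\<in>X. q x = (\<Sum>l<L. x (n::nat) ^ l * c l (g x)))"
  shows "spanned X (L * M) F"
proof -
  obtain b where b: "\<And>p. dpoly n E p \<Longrightarrow> \<exists>c. \<forall>y\<in>Y. p y = (\<Sum>i<M. c i * b i y)"
    using Y(1) by (auto simp: spanned_def)
  show ?thesis
  proof (rule spannedI[of "{..<L} \<times> {..<M}", where b = "\<lambda>(l, i) x. x n ^ l * b i (g x)"])
    fix q assume "q \<in> F"
    from F[OF this] obtain c where c: "\<And>l. l < L \<Longrightarrow> dpoly n E (c l)"
      "\<And>x. x \<in> X \<Longrightarrow> q x = (\<Sum>l<L. x n ^ l * c l (g x))" by auto
    have "\<forall>l. \<exists>e. l < L \<longrightarrow> (\<forall>y\<in>Y. c l y = (\<Sum>i<M. e i * b i y))" using b c(1) by simp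
    from choice[OF this] obtain e where
      e: "\<And>l y. l < L \<Longrightarrow> y \<in> Y \<Longrightarrow> c l y = (\<Sum>i<M. e l i * b i y)" by auto
    have "q x = (\<Sum>(l, i)\<in>{..<L} \<times> {..<M}. e l i * (x n ^ l * b i (g x)))" if "x \<in> X" for x
      unfolding sum.cartesian_product[symmetric] c(2)[OF that]
      using e Y(2)[OF that] by (intro sum.cong) (auto simp: sum_distrib_left algebra_simps)
    then show "\<exists>e. \<forall>x\<in>X. q x = (\<Sum>j\<in>{..<L} \<times> {..<M}. e j * (case j of (l, i) \<Rightarrow> \<lambda>x. x n ^ l * b i (g x)) x)"
      by (intro exI[of _ "\<lambda>(l, i). e l i"]) (simp add: case_prod_unfold)
  qed auto
qed

text \<open>Expanding along the last axis gives D + 1 powers of the last coordinate with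
  coefficients of degree at most D, so each variable contributes a factor D + 1.\<close>

lemma growth_cspace: "growth n (cspace n) n"
proof (induction n)
  case 0
  have "\<exists>c. \<forall>x\<in>cspace 0. p x = (\<Sum>i<1::nat. c i * 1)" if "dpoly 0 D p" for D p
  proof -
    have "p x = (\<Sum>i<1::nat. p origin * 1)" for x
      using cpoly_cong[OF dpoly_imp_cpoly[OF that], of x origin] by simp
    then show ?thesis by (intro exI[of _ "\<lambda>_. p origin"]) blast
  qed
  then have "spanned (cspace 0) (1 * (D + 1) ^ 0) {p. dpoly 0 D p}" for D
    unfolding spanned_def by (intro exI[of _ "\<lambda>_ _. 1"]) simp
  then show ?case unfolding growth_def by blast
next
  case (Suc n)
  then obtain C where C: "\<And>D. spanned (cspace n) (C * (D + 1) ^ n) {p. dpoly n D p}"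
    by (auto simp: growth_def)
  have "\<exists>c. (\<forall>l<D+1. dpoly n D (c l)) \<and>
      (\<forall>x\<in>cspace (Suc n). q x = (\<Sum>l<D+1. x n ^ l * c l (proj n origin x)))"
    if q: "dpoly (Suc n) D q" for q D
  proof -
    obtain h where h: "\<And>j. hpoly (Suc n) j (h j)" "\<And>x. q x = (\<Sum>j\<le>D. h j x)"
      using dpoly_homogeneous_parts[OF q] by blast
    obtain B where B: "\<And>y t. (\<Sum>j\<le>D. h j (lift n origin y t)) = poly (B y) t"
       "\<And>y. degree (B y) \<le> D \<and> coeff (B y) D = h D (lift n origin origin 1)"
       "\<And>i. dpoly n D (\<lambda>y. coeff (B y) i)"
      using dpoly_lift[where h = h and n = n and u = origin and d = D, OF h(1)] by blast
    have "q x = (\<Sum>l<D+1. x n ^ l * coeff (B (proj n origin x)) l)" if "x \<in> cspace (Suc n)" for x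
    proof -
      have "q x = poly (B (proj n origin x)) (x n)"
        using B(1)[of "proj n origin x" "x n"] lift_proj[OF that, of origin] h(2) by simp
      also have "\<dots> = (\<Sum>l\<le>D. coeff (B (proj n origin x)) l * x n ^ l)"
        unfolding poly_altdef using B(2)
        by (intro sum.mono_neutral_left) (auto simp: coeff_eq_0)
      finally show ?thesis by (simp add: lessThan_Suc_atMost mult.commute)
    qed
    then show ?thesis using B(3) by (intro exI[of _ "\<lambda>l y. coeff (B y) l"]) simp
  qed
  then have "spanned (cspace (Suc n)) ((D + 1) * (C * (D + 1) ^ n)) {p. dpoly (Suc n) D p}" for D
    using proj_in_cspace by (intro spanned_proj[OF C, where g = "proj n origin"]) auto
  then show ?case unfolding growth_def by (intro exI[of _ C]) (simp add: algebra_simps)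
qed

text \<open>The degree bound \<open>d * D\<close> is crude: each multiplication by a coordinate, followed by a reduction
  modulo \<open>B y\<close>, raises the degrees of the coefficients by at most \<open>d\<close>.\<close>

lemma reduce_mod_monic:
  assumes B: "\<And>y. coeff (B y) d = a" "\<And>y. degree (B y) = d" "a \<noteq> 0" "0 < d"
     "\<And>i. dpoly n d (\<lambda>y. coeff (B y) i)"
    and X: "X \<subseteq> cspace (Suc n)" "\<And>x. x \<in> X \<Longrightarrow> poly (B (proj n u x)) (x n) = 0"
    and q: "dpoly (Suc n) D q"
  shows "\<exists>c. (\<forall>l. dpoly n (d * D) (c l)) \<and>
             (\<forall>x\<in>X. q x = (\<Sum>l<d. x n ^ l * c l (proj n u x)))"
  using q
proof (induction rule: dpoly.induct)
  case (const D c)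
  have "dpoly n (d * D) (if l = 0 then (\<lambda>_. c) else (\<lambda>_. 0))" for l :: nat
    by (auto intro: dpoly.const)
  moreover have "c = (\<Sum>l<d. t ^ l * (if l = 0 then (\<lambda>_. c) else (\<lambda>_. 0)) y)" for t y
  proof -
    have "(\<Sum>l<d. t ^ l * (if l = 0 then (\<lambda>_. c) else (\<lambda>_. 0)) y) = (\<Sum>l<d. if l = 0 then c else 0)"
      by (intro sum.cong) auto
    then show ?thesis using B(4) by simp
  qed
  ultimately show ?case
    by (intro exI[of _ "\<lambda>l. if l = 0 then (\<lambda>_. c) else (\<lambda>_. 0)"] conjI allI ballI)
next
  case (var j D q)
  then obtain c where c: "\<And>l. dpoly n (d * D) (c l)"
    "\<And>x. x \<in> X \<Longrightarrow> q x = (\<Sum>l<d. x n ^ l * c l (proj n u x))" by blast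
  \<comment> \<open>On the line over y, coordinate j is v y + t * w, both for j < n and for j =
    n.\<close>
  define v where "v y = (if j < n then y j else 0)" for y :: "nat \<Rightarrow> complex"
  define w where "w = (if j < n then u j else 1)"
  \<comment> \<open>The coefficients of t times the old sum: a shift by one, with the overflow at
    t^d rewritten in lower powers by means of poly (B y) t = 0.\<close>
  define s where "s l y = (if l = 0 then 0 else c (l - 1) y) - c (d - 1) y * coeff (B y) l / a" for l y
  define c' where "c' l y = v y * c l y + w * s l y" for l y
  have v: "dpoly n d v"
  proof (cases "j < n")
    case True
    then have "v = (\<lambda>y. y j)" by (simp add: v_def fun_eq_iff)
    moreover have "dpoly n d (\<lambda>y. y j)"
      using dpoly_coord[OF True] B(4) by (auto elim: dpoly_mono)
    ultimately show ?thesis by simp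
  next
    case False
    then have "v = (\<lambda>_. 0)" by (simp add: v_def fun_eq_iff)
    then show ?thesis by (simp add: dpoly.const)
  qed
  have "dpoly n (d * Suc D) (c' l)" for l
  proof -
    have 1: "dpoly n (d * Suc D) (\<lambda>y. v y * c l y)"
      using dpoly_mult[OF v c(1)] by simp
    have 2: "dpoly n (d * Suc D) (\<lambda>y. if l = 0 then 0 else c (l - 1) y)"
      using dpoly_mono[OF c(1), of "d * Suc D"] by (cases "l = 0") (auto intro: dpoly.const)
    have 3: "dpoly n (d * Suc D) (\<lambda>y. (- 1 / a) * (coeff (B y) l * c (d - 1) y))"
      using dpoly_cmult[OF dpoly_mult[OF B(5)[of l] c(1)[of "d - 1"]], of "- 1 / a"] by simp
    have "dpoly n (d * Suc D) (\<lambda>y. v y * c l y + w * ((if l = 0 then 0 else c (l - 1) y)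
        + (- 1 / a) * (coeff (B y) l * c (d - 1) y)))"
      by (intro dpoly.add 1 dpoly_cmult 2 3)
    then show ?thesis by (simp add: c'_def[abs_def] s_def mult.commute)
  qed
  moreover have "x j * q x = (\<Sum>l<d. x n ^ l * c' l (proj n u x))" if x: "x \<in> X" for x
  proof -
    define y t where "y = proj n u x" and "t = x n"
    have xj: "x j = v y + t * w"
      using var.hyps(1) by (auto simp: v_def w_def y_def t_def proj_def less_Suc_eq)
    obtain d' where d': "d = Suc d'" using B(4) by (cases d) auto
    have "0 = (\<Sum>l\<le>d. coeff (B y) l * t ^ l)"
      using X(2)[OF x] B(2)[of y] by (simp add: poly_altdef y_def t_def)
    also have "\<dots> = (\<Sum>l<d. t ^ l * coeff (B y) l) + a * t ^ d"
      using B(1) by (simp add: lessThan_Suc_atMost[symmetric] mult.commute)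
    finally have "t ^ d = - (\<Sum>l<d. t ^ l * coeff (B y) l) / a"
      using B(3) by (simp add: field_simps add_eq_0_iff2)
    then have td: "t ^ d = (\<Sum>l<d. t ^ l * (- coeff (B y) l / a))"
      by (simp add: sum_divide_distrib sum_negf)
    have "t * (\<Sum>l<d. t ^ l * c l y) = (\<Sum>l<d'. t ^ Suc l * c l y) + t ^ d * c d' y"
      by (simp add: d' sum_distrib_left algebra_simps)
    also have "(\<Sum>l<d'. t ^ Suc l * c l y) = (\<Sum>l<d. t ^ l * (if l = 0 then 0 else c (l - 1) y))"
      by (simp add: d' sum.lessThan_Suc_shift del: sum.lessThan_Suc)
    also have "\<dots> + t ^ d * c d' y = (\<Sum>l<d. t ^ l * s l y)"
      unfolding td sum_distrib_right sum.distrib[symmetric]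
      by (intro sum.cong) (auto simp: s_def d' field_simps)
    finally have "t * (\<Sum>l<d. t ^ l * c l y) = (\<Sum>l<d. t ^ l * s l y)" .
    moreover have "x j * q x = v y * (\<Sum>l<d. t ^ l * c l y) + w * (t * (\<Sum>l<d. t ^ l * c l y))"
      unfolding xj c(2)[OF x] y_def[symmetric] t_def[symmetric] by (simp add: algebra_simps)
    ultimately have "x j * q x = v y * (\<Sum>l<d. t ^ l * c l y) + w * (\<Sum>l<d. t ^ l * s l y)"
      by simp
    also have "\<dots> = (\<Sum>l<d. t ^ l * c' l y)"
      by (simp add: c'_def sum_distrib_left sum.distrib[symmetric] algebra_simps)
    finally show ?thesis by (simp add: y_def t_def)
  qed
  ultimately show ?case by blast
next
  case (add D q r)
  then obtain c e where c: "\<And>l. dpoly n (d * D) (c l)"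
      "\<And>x. x \<in> X \<Longrightarrow> q x = (\<Sum>l<d. x n ^ l * c l (proj n u x))"
    and e: "\<And>l. dpoly n (d * D) (e l)"
      "\<And>x. x \<in> X \<Longrightarrow> r x = (\<Sum>l<d. x n ^ l * e l (proj n u x))" by blast
  have "dpoly n (d * D) (\<lambda>y. c l y + e l y)" for l using c(1) e(1) by (rule dpoly.add)
  moreover have "q x + r x = (\<Sum>l<d. x n ^ l * (c l (proj n u x) + e l (proj n u x)))" if "x \<in> X" for x
    using c(2)[OF that] e(2)[OF that] by (simp add: sum.distrib distrib_left)
  ultimately show ?case by (intro exI[of _ "\<lambda>l y. c l y + e l y"]) blast
qed

text \<open>By \<open>reduce_mod_monic\<close>, d powers of the last coordinate with coefficients of
  degree d D suffice. As d D + 1 <= d (D + 1), the exponent k stays and only the constant grows,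
  from C to d C d^k.\<close>

lemma growth_proj:
  assumes h: "\<And>j. hpoly (Suc n) j (h j)" and X: "X \<subseteq> cspace (Suc n)"
    and 0: "\<And>x. x \<in> X \<Longrightarrow> (\<Sum>j\<le>d. h j x) = 0" and u: "h d (lift n u origin 1) \<noteq> 0"
    and g: "growth n (proj n u ` X) k"
  shows "growth (Suc n) X k"
proof -
  obtain B where B: "\<And>y t. (\<Sum>j\<le>d. h j (lift n u y t)) = poly (B y) t"
     "\<And>y. degree (B y) \<le> d \<and> coeff (B y) d = h d (lift n u origin 1)"
     "\<And>i. dpoly n d (\<lambda>y. coeff (B y) i)"
    using dpoly_lift[where h = h and n = n and u = u and d = d, OF h] by blast
  have deg: "degree (B y) = d" for y using B(2)[of y] u le_degree[of "B y" d] by auto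
  have root: "poly (B (proj n u x)) (x n) = 0" if "x \<in> X" for x
  proof -
    have "lift n u (proj n u x) (x n) = x" using X that by (auto intro: lift_proj)
    then show ?thesis using B(1)[of "proj n u x" "x n"] 0[OF that] by simp
  qed
  show ?thesis
  proof (cases "d = 0")
    case True
    \<comment> \<open>A nonzero constant B y has no roots, while every point of X would provide
      one.\<close>
    have "X = {}"
    proof (rule ccontr)
      assume "X \<noteq> {}"
      then obtain x where x: "x \<in> X" by blast
      have "poly (B (proj n u x)) (x n) = coeff (B (proj n u x)) 0"
        using deg True by (simp add: poly_altdef)
      then show False using root[OF x] B(2) u True by simp
    qed
    then show ?thesis by (simp add: growth_def spanned_def)
  next
    case False
    obtain C where C: "\<And>D. spanned (proj n u ` X) (C * (D + 1) ^ k) {p. dpoly n D p}"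
      using g by (auto simp: growth_def)
    have "spanned X (d * C * d ^ k * (D + 1) ^ k) {p. dpoly (Suc n) D p}" for D
    proof (rule spanned_mono)
      show "spanned X (d * (C * (d * D + 1) ^ k)) {p. dpoly (Suc n) D p}"
      proof (rule spanned_proj[OF C, where g = "proj n u"])
        fix q assume "q \<in> {p. dpoly (Suc n) D p}"
        then have "dpoly (Suc n) D q" by simp
        from reduce_mod_monic[where B = B and u = u, OF _ deg u _ B(3) X root this]
        show "\<exists>c. (\<forall>l<d. dpoly n (d * D) (c l)) \<and>
            (\<forall>x\<in>X. q x = (\<Sum>l<d. x n ^ l * c l (proj n u x)))"
          using B(2) False by blast
      qed simp
      have "(d * D + 1) ^ k \<le> (d * (D + 1)) ^ k" using False by (intro power_mono) auto
      then have "d * C * (d * D + 1) ^ k \<le> d * C * (d * (D + 1)) ^ k" by (rule mult_le_mono2)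
      then show "d * (C * (d * D + 1) ^ k) \<le> d * C * d ^ k * (D + 1) ^ k"
        by (simp only: power_mult_distrib mult.assoc)
    qed
    then show ?thesis unfolding growth_def by blast
  qed
qed

text \<open>A polynomial that vanishes on X but not on the whole space gives a finite projection to
  one dimension less; the recursion stops at a full affine space. There the growth exponent is the
  number of variables, and it is pulled back unchanged.\<close>

lemma Noether_normalization:
  assumes "algebraic_set n X" "X \<noteq> {}"
  shows "\<exists>m g. finite_map n X m g \<and> g ` X = cspace m \<and> growth n X m"
  using assms
proof (induction n arbitrary: X)
  case 0
  have "cspace 0 = {origin}" by (auto simp: cspace_def)
  then have X: "X = cspace 0" using 0 algebraic_set_subset[of 0 X] by auto
  have "finite_map 0 X 0 (\<lambda>x. x)" using X by (simp add: finite_map_id)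
  then show ?case using growth_cspace[of 0] X by (intro exI[of _ 0] exI[of _ "\<lambda>x. x"]) simp
next
  case (Suc n)
  show ?case
  proof (cases "X = cspace (Suc n)")
    case True
    then show ?thesis using finite_map_id[of X "Suc n"] growth_cspace[of "Suc n"]
      by (intro exI[of _ "Suc n"] exI[of _ "\<lambda>x. x"]) simp
  next
    case False
    then obtain a where a: "a \<in> cspace (Suc n)" "a \<notin> X"
      using algebraic_set_subset[OF Suc.prems(1)] by auto
    obtain p where p: "cpoly (Suc n) p" "\<forall>x\<in>X. p x = 0" "p a \<noteq> 0"
      using algebraic_set_separate[OF Suc.prems(1) a] .
    obtain D where "dpoly (Suc n) D p" using cpoly_imp_dpoly[OF p(1)] by blast
    then obtain h where h: "\<And>j. hpoly (Suc n) j (h j)" "\<And>x. p x = (\<Sum>j\<le>D. h j x)"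
      using dpoly_homogeneous_parts by blast
    \<comment> \<open>D merely bounds the degree. The largest index in J belongs to a form that is
      not identically zero, so a direction outside its zeros exists.\<close>
    define J where "J = {j. j \<le> D \<and> (\<exists>x. h j x \<noteq> 0)}"
    have J: "finite J" by (simp add: J_def)
    have "\<exists>j\<in>{..D}. h j a \<noteq> 0" using p(3) h(2)[of a] sum.not_neutral_contains_not_neutral by metis
    then have "J \<noteq> {}" by (auto simp: J_def)
    define d where "d = Max J"
    have d: "d \<in> J" using J \<open>J \<noteq> {}\<close> by (simp add: d_def)
    have top: "p x = (\<Sum>j\<le>d. h j x)" for x
      unfolding h(2)
    proof (rule sum.mono_neutral_right)
      show "{..d} \<subseteq> {..D}" using d by (auto simp: J_def)
      show "\<forall>j\<in>{..D} - {..d}. h j x = 0"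
      proof
        fix j assume j: "j \<in> {..D} - {..d}"
        then have "j \<notin> J" using Max_ge[OF J] by (auto simp: d_def)
        then show "h j x = 0" using j by (auto simp: J_def)
      qed
    qed simp
    obtain w where "h d w \<noteq> 0" using d by (auto simp: J_def)
    then obtain u where u: "h d (lift n u origin 1) \<noteq> 0"
      using ex_direction[OF h(1) h(1)] by blast
    have 0: "(\<Sum>j\<le>d. h j x) = 0" if "x \<in> X" for x using p(2) that top by simp
    have fm: "finite_map (Suc n) X n (proj n u)"
      using finite_map_proj[where h = h, OF h(1) Suc.prems(1) 0 u] .
    then have "algebraic_set n (proj n u ` X)"
      using Suc.prems(1) by (simp add: finite_map_def)
    from Suc.IH[OF this] Suc.prems(2) obtain m g where
      g: "finite_map n (proj n u ` X) m g" "g ` proj n u ` X = cspace m" "growth n (proj n u ` X) m"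
      by auto
    have "growth (Suc n) X m"
      using growth_proj[where h = h, OF h(1) algebraic_set_subset[OF Suc.prems(1)] 0 u g(3)] .
    moreover have "finite_map (Suc n) X m (\<lambda>x. g (proj n u x))"
      using finite_map_compose[OF fm g(1)] .
    ultimately show ?thesis using g(2)
      by (intro exI[of _ m] exI[of _ "\<lambda>x. g (proj n u x)"]) (simp add: image_image)
  qed
qed

section \<open>Existence of vanishing polynomials\<close>

text \<open>Gaussian elimination on equation j: multiples of a pivot row i0 are subtracted from the
  other rows, and the coefficient of i0 is finally solved from equation j.\<close>

lemma ex_linear_dependence:
  fixes a :: "'i \<Rightarrow> 'j \<Rightarrow> 'f::field"
  assumes "finite J" "finite I" "card J < card I"
  shows "\<exists>c. (\<exists>i\<in>I. c i \<noteq> 0) \<and> (\<forall>j\<in>J. (\<Sum>i\<in>I. c i * a i j) = 0)"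
  using assms
proof (induction J arbitrary: I a)
  case empty
  then obtain i where "i \<in> I" by fastforce
  then show ?case by (intro exI[of _ "\<lambda>_. 1"]) auto
next
  case (insert j J)
  show ?case
  proof (cases "\<forall>i\<in>I. a i j = 0")
    case True
    obtain c where c: "\<exists>i\<in>I. c i \<noteq> 0" "\<forall>l\<in>J. (\<Sum>i\<in>I. c i * a i l) = 0"
      using insert.IH[of I a] insert.prems insert.hyps by auto
    moreover have "(\<Sum>i\<in>I. c i * a i j) = 0" using True by simp
    ultimately show ?thesis by (intro exI[of _ c]) simp
  next
    case False
    then obtain i0 where i0: "i0 \<in> I" "a i0 j \<noteq> 0" by auto
    define I' where "I' = I - {i0}"
    have I: "I = insert i0 I'" "i0 \<notin> I'" "finite I'" using i0(1) insert.prems(1) by (auto simp: I'_def)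
    define a' where "a' i l = a i l - a i j / a i0 j * a i0 l" for i l
    have "card J < card I'" using insert.prems insert.hyps I by simp
    then obtain c where c: "\<exists>i\<in>I'. c i \<noteq> 0" "\<forall>l\<in>J. (\<Sum>i\<in>I'. c i * a' i l) = 0"
      using insert.IH[of I' a'] I(3) by auto
    define c' where "c' = c(i0 := - (\<Sum>i\<in>I'. c i * a i j) / a i0 j)"
    have rest: "(\<Sum>i\<in>I'. c' i * a i l) = (\<Sum>i\<in>I'. c i * a i l)" for l
      using I(2) by (intro sum.cong) (auto simp: c'_def)
    have eq: "(\<Sum>i\<in>I. c' i * a i l) = (\<Sum>i\<in>I'. c i * a' i l)" for l
    proof -
      have "(\<Sum>i\<in>I. c' i * a i l) = c' i0 * a i0 l + (\<Sum>i\<in>I'. c i * a i l)"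
        using I rest by simp
      also have "c' i0 * a i0 l = - (\<Sum>i\<in>I'. c i * (a i j / a i0 j * a i0 l))"
        by (simp add: c'_def sum_distrib_right sum_distrib_left sum_divide_distrib field_simps sum_negf)
      also have "- (\<Sum>i\<in>I'. c i * (a i j / a i0 j * a i0 l)) + (\<Sum>i\<in>I'. c i * a i l)
          = (\<Sum>i\<in>I'. c i * a' i l)"
        by (simp add: a'_def right_diff_distrib sum_subtractf)
      finally show ?thesis .
    qed
    have "a' i j = 0" for i using i0(2) by (simp add: a'_def)
    then have "\<forall>l\<in>insert j J. (\<Sum>i\<in>I. c' i * a i l) = 0" using c(2) unfolding eq by simp
    moreover have "\<exists>i\<in>I. c' i \<noteq> 0" using c(1) I by (auto simp: c'_def)
    ultimately show ?thesis by blast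
  qed
qed

lemma spanned_dependent:
  assumes "spanned Y M F" "finite A" "M < card A" "\<And>\<alpha>. \<alpha> \<in> A \<Longrightarrow> f \<alpha> \<in> F"
  shows "\<exists>c. (\<exists>\<alpha>\<in>A. c \<alpha> \<noteq> 0) \<and> (\<forall>x\<in>Y. (\<Sum>\<alpha>\<in>A. c \<alpha> * f \<alpha> x) = 0)"
proof -
  obtain b where b: "\<forall>p\<in>F. \<exists>c. \<forall>x\<in>Y. p x = (\<Sum>i<M. c i * b i x)"
    using assms(1) by (auto simp: spanned_def)
  have "\<forall>\<alpha>. \<exists>e. \<alpha> \<in> A \<longrightarrow> (\<forall>x\<in>Y. f \<alpha> x = (\<Sum>i<M. e i * b i x))" using b assms(4) by simp
  from choice[OF this] obtain e where
    e: "\<And>\<alpha> x. \<alpha> \<in> A \<Longrightarrow> x \<in> Y \<Longrightarrow> f \<alpha> x = (\<Sum>i<M. e \<alpha> i * b i x)" by auto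
  obtain c where c: "\<exists>\<alpha>\<in>A. c \<alpha> \<noteq> 0" "\<And>i. i < M \<Longrightarrow> (\<Sum>\<alpha>\<in>A. c \<alpha> * e \<alpha> i) = 0"
    using ex_linear_dependence[of "{..<M}" A e] assms(2,3) by auto
  have "(\<Sum>\<alpha>\<in>A. c \<alpha> * f \<alpha> x) = 0" if "x \<in> Y" for x
  proof -
    have "(\<Sum>\<alpha>\<in>A. c \<alpha> * f \<alpha> x) = (\<Sum>\<alpha>\<in>A. \<Sum>i<M. c \<alpha> * e \<alpha> i * b i x)"
      using e that by (intro sum.cong) (auto simp: sum_distrib_left mult.assoc)
    also have "\<dots> = (\<Sum>i<M. (\<Sum>\<alpha>\<in>A. c \<alpha> * e \<alpha> i) * b i x)"
      by (subst sum.swap) (simp add: sum_distrib_right)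
    also have "\<dots> = 0" using c(2) by simp
    finally show ?thesis .
  qed
  then show ?thesis using c(1) by blast
qed

text \<open>Bounding each exponent separately makes the number of monomials exactly (E + 1)^n, while
  total degrees are at most n E.\<close>

definition exponents :: "nat \<Rightarrow> nat \<Rightarrow> (nat \<Rightarrow> nat) set" where
  "exponents n E = (\<Pi>\<^sub>E i\<in>{..<n}. {..E})"

lemma finite_exponents: "finite (exponents n E)"
  unfolding exponents_def by (intro finite_PiE) auto

lemma card_exponents: "card (exponents n E) = (E + 1) ^ n"
  unfolding exponents_def by (simp add: card_PiE)

lemma exponents_le: "\<alpha> \<in> exponents n E \<Longrightarrow> i < n \<Longrightarrow> \<alpha> i \<le> E"
  unfolding exponents_def by (auto simp: PiE_iff)

lemma sum_exponents_le: "\<alpha> \<in> exponents n E \<Longrightarrow> (\<Sum>i<n. \<alpha> i) \<le> n * E"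
  using sum_bounded_above[of "{..<n}" \<alpha> E] exponents_le by auto

lemma sum_exponents_Suc:
  "(\<Sum>\<alpha>\<in>exponents (Suc n) E. f \<alpha>) = (\<Sum>e\<le>E. \<Sum>\<alpha>\<in>exponents n E. f (\<alpha>(n := e)))"
proof -
  have "exponents (Suc n) E = (\<lambda>(e, \<alpha>). \<alpha>(n := e)) ` ({..E} \<times> exponents n E)"
    unfolding exponents_def lessThan_Suc by (rule PiE_insert_eq)
  moreover have "inj_on (\<lambda>(e, \<alpha>). \<alpha>(n := e)) ({..E} \<times> exponents n E)"
    unfolding exponents_def by (rule inj_combinator) simp
  ultimately show ?thesis
    by (simp add: sum.reindex sum.cartesian_product case_prod_unfold)
qed

text \<open>As a polynomial in the last variable t the sum has vanishing coefficients, and these are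
  sums of the same kind in one variable fewer.\<close>

lemma monomials_independent:
  fixes c :: "(nat \<Rightarrow> nat) \<Rightarrow> complex"
  assumes "\<forall>w. (\<Sum>\<alpha>\<in>exponents n E. c \<alpha> * (\<Prod>i<n. w i ^ \<alpha> i)) = 0"
  shows "\<forall>\<alpha>\<in>exponents n E. c \<alpha> = 0"
  using assms
proof (induction n arbitrary: c)
  case 0
  then show ?case by (simp add: exponents_def)
next
  case (Suc n)
  have zero: "(\<Sum>\<alpha>\<in>exponents n E. c (\<alpha>(n := e)) * (\<Prod>i<n. w i ^ \<alpha> i)) = 0" if "e \<le> E" for e w
  proof -
    have "(\<Sum>e\<le>E. (\<Sum>\<alpha>\<in>exponents n E. c (\<alpha>(n := e)) * (\<Prod>i<n. w i ^ \<alpha> i)) * t ^ e) = 0" for t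
    proof -
      have "(\<Sum>e\<le>E. (\<Sum>\<alpha>\<in>exponents n E. c (\<alpha>(n := e)) * (\<Prod>i<n. w i ^ \<alpha> i)) * t ^ e)
        = (\<Sum>\<alpha>\<in>exponents (Suc n) E. c \<alpha> * (\<Prod>i<Suc n. (w(n := t)) i ^ \<alpha> i))"
        unfolding sum_exponents_Suc by (intro sum.cong) (auto simp: sum_distrib_right mult.assoc)
      then show ?thesis using Suc.prems[rule_format, of "w(n := t)"] by (rule trans)
    qed
    then show ?thesis
      using that zero_polynom_imp_zero_coeffs[of "\<lambda>e. \<Sum>\<alpha>\<in>exponents n E. c (\<alpha>(n := e)) * (\<Prod>i<n. w i ^ \<alpha> i)" E e]
      by blast
  qed
  show ?case
  proof
    fix \<alpha> assume \<alpha>: "\<alpha> \<in> exponents (Suc n) E"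
    \<comment> \<open>Members of \<open>exponents n E\<close> are \<open>undefined\<close> from n
      on, so the last exponent is erased to this value, not to 0.\<close>
    define \<beta> where "\<beta> = \<alpha>(n := undefined)"
    have "\<beta> \<in> exponents n E" using \<alpha> by (auto simp: \<beta>_def exponents_def PiE_iff extensional_def)
    moreover have "\<alpha> = \<beta>(n := \<alpha> n)" by (simp add: \<beta>_def)
    moreover have "\<alpha> n \<le> E" using \<alpha> exponents_le by blast
    ultimately show "c \<alpha> = 0" using Suc.IH[of "\<lambda>\<beta>. c (\<beta>(n := \<alpha> n))"] zero[of "\<alpha> n"] by metis
  qed
qed

lemma hpoly_power: "i < n \<Longrightarrow> hpoly n d p \<Longrightarrow> hpoly n (a + d) (\<lambda>x. x i ^ a * p x)"
proof (induction a)
  case (Suc a)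
  from hpoly.var[OF Suc.prems(1) Suc.IH[OF Suc.prems]] show ?case by (simp add: mult.assoc)
qed simp

lemma hpoly_monomial: "m \<le> n \<Longrightarrow> hpoly n (\<Sum>i<m. \<alpha> i) (\<lambda>x. \<Prod>i<m. x i ^ \<alpha> i)"
proof (induction m)
  case 0
  show ?case by (simp add: hpoly.const)
next
  case (Suc m)
  then have "m < n" "hpoly n (\<Sum>i<m. \<alpha> i) (\<lambda>x. \<Prod>i<m. x i ^ \<alpha> i)" by auto
  from hpoly_power[OF this, of "\<alpha> m"] show ?case by (simp add: add.commute mult.commute)
qed

text \<open>G cuts out a cone containing X, and the cone over X should have dimension at most k + 1,
  less than m + 1. Monomials in the first m variables are brought to a common degree D by powers of
  \<open>x m\<close>; setting \<open>x m\<close> to 1 recovers their independence.\<close>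

lemma ex_hpoly_vanishing:
  assumes "growth (Suc m) X k" "k < m"
  shows "\<exists>D G w. hpoly (Suc m) D G \<and> (\<forall>x\<in>X. G x = 0) \<and> G w \<noteq> 0"
proof -
  obtain C where C: "\<And>D. spanned X (C * (D + 1) ^ k) {p. dpoly (Suc m) D p}"
    using assms(1) by (auto simp: growth_def)
  \<comment> \<open>Chosen so that C (m E + 1)^k <= E (E + 1)^k < (E + 1)^(k + 1), which is at most
    the number of monomials.\<close>
  define E where "E = C * (m + 1) ^ k"
  define D where "D = m * E"
  define f where "f \<alpha> x = x m ^ (D - (\<Sum>i<m. \<alpha> i)) * (\<Prod>i<m. x i ^ \<alpha> i)"
    for \<alpha> :: "nat \<Rightarrow> nat" and x :: "nat \<Rightarrow> complex"
  have f: "hpoly (Suc m) D (f \<alpha>)" if "\<alpha> \<in> exponents m E" for \<alpha>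
    using hpoly_power[OF lessI hpoly_monomial[OF le_SucI[OF order_refl]], of m "D - (\<Sum>i<m. \<alpha> i)" \<alpha>]
      sum_exponents_le[OF that] by (simp add: f_def[abs_def] D_def)
  have "C * (D + 1) ^ k \<le> C * ((m + 1) * (E + 1)) ^ k"
    by (intro mult_le_mono2 power_mono) (auto simp: D_def)
  also have "\<dots> = E * (E + 1) ^ k" by (simp only: E_def power_mult_distrib mult.assoc)
  also have "\<dots> < (E + 1) ^ Suc k" by simp
  also have "\<dots> \<le> (E + 1) ^ m" using assms(2) by (intro power_increasing) auto
  finally have "C * (D + 1) ^ k < card (exponents m E)" by (simp add: card_exponents)
  from spanned_dependent[OF C finite_exponents this, of f] f hpoly_imp_dpoly
  obtain c where c: "\<exists>\<alpha>\<in>exponents m E. c \<alpha> \<noteq> 0"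
      "\<forall>x\<in>X. (\<Sum>\<alpha>\<in>exponents m E. c \<alpha> * f \<alpha> x) = 0" by auto
  obtain w where w: "(\<Sum>\<alpha>\<in>exponents m E. c \<alpha> * (\<Prod>i<m. w i ^ \<alpha> i)) \<noteq> 0"
    using monomials_independent[of c m E] c(1) by blast
  have "f \<alpha> (w(m := 1)) = (\<Prod>i<m. w i ^ \<alpha> i)" for \<alpha> by (simp add: f_def)
  then have "(\<Sum>\<alpha>\<in>exponents m E. c \<alpha> * f \<alpha> (w(m := 1))) \<noteq> 0" using w by simp
  moreover have "hpoly (Suc m) D (\<lambda>x. \<Sum>\<alpha>\<in>exponents m E. c \<alpha> * f \<alpha> x)"
    by (intro hpoly_sum hpoly_cmult f)
  ultimately show ?thesis using c(2) by blast
qed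

text \<open>The tensor square of the polynomials of degree at most d, as functions on pairs of
  points.\<close>

inductive bipoly :: "nat \<Rightarrow> nat \<Rightarrow> ((nat \<Rightarrow> complex) \<times> (nat \<Rightarrow> complex) \<Rightarrow> complex) \<Rightarrow> bool"
  for n d where
  prod: "dpoly n d p \<Longrightarrow> dpoly n d q \<Longrightarrow> bipoly n d (\<lambda>(x, y). p x * q y)"
| add: "bipoly n d f \<Longrightarrow> bipoly n d g \<Longrightarrow> bipoly n d (\<lambda>z. f z + g z)"

lemma bipoly_diff_mult:
  assumes "i < n"
  shows "bipoly n d f \<Longrightarrow> bipoly n (Suc d) (\<lambda>z. (fst z i - snd z i) * f z)"
proof (induction rule: bipoly.induct)
  case (prod p q)
  have p: "dpoly n (Suc d) p" and q: "dpoly n (Suc d) q" using prod by (auto elim: dpoly_mono)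
  have "bipoly n (Suc d) (\<lambda>(x, y). (x i * p x) * q y)"
    using dpoly.var[OF assms prod(1)] q by (rule bipoly.prod)
  moreover have "bipoly n (Suc d) (\<lambda>(x, y). p x * (- 1 * (y i * q y)))"
    using p dpoly_cmult[OF dpoly.var[OF assms prod(2)]] by (rule bipoly.prod)
  ultimately have "bipoly n (Suc d) (\<lambda>z. (\<lambda>(x, y). (x i * p x) * q y) z
      + (\<lambda>(x, y). p x * (- 1 * (y i * q y))) z)" by (rule bipoly.add)
  then show ?case by (simp add: case_prod_unfold algebra_simps)
next
  case (add f g)
  from bipoly.add[OF add.IH] show ?case by (simp add: algebra_simps)
qed

lemma dpoly_diff_bipoly: "dpoly n d p \<Longrightarrow> bipoly n d (\<lambda>z. p (\<lambda>i. fst z i - snd z i))"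
proof (induction rule: dpoly.induct)
  case (const d c)
  from bipoly.prod[OF dpoly.const[of n d c] dpoly.const[of n d 1]] show ?case
    by (simp add: case_prod_unfold)
qed (auto intro: bipoly.add bipoly_diff_mult)

lemma spanned_bipoly:
  assumes "spanned X M {p. dpoly n d p}"
  shows "spanned (X \<times> X) (M * M) {f. bipoly n d f}"
proof -
  obtain b where b: "\<And>p. dpoly n d p \<Longrightarrow> \<exists>c. \<forall>x\<in>X. p x = (\<Sum>i<M. c i * b i x)"
    using assms by (auto simp: spanned_def)
  define b2 where "b2 = (\<lambda>(i, j) (x, y). b i x * b j y)"
  have "\<exists>c. \<forall>z\<in>X \<times> X. f z = (\<Sum>s\<in>{..<M} \<times> {..<M}. c s * b2 s z)" if "bipoly n d f" for f
    using that
  proof (induction rule: bipoly.induct)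
    case (prod p q)
    obtain c where c: "\<forall>x\<in>X. p x = (\<Sum>i<M. c i * b i x)" using b[OF prod(1)] by blast
    obtain e where e: "\<forall>x\<in>X. q x = (\<Sum>i<M. e i * b i x)" using b[OF prod(2)] by blast
    have "p x * q y = (\<Sum>s\<in>{..<M} \<times> {..<M}. (c (fst s) * e (snd s)) * b2 s (x, y))"
      if "x \<in> X" "y \<in> X" for x y
      using c e that
      by (simp add: sum_product sum.cartesian_product b2_def case_prod_unfold algebra_simps)
    then show ?case by (intro exI[of _ "\<lambda>s. c (fst s) * e (snd s)"]) auto
  next
    case (add f g)
    then obtain c e where "\<forall>z\<in>X \<times> X. f z = (\<Sum>s\<in>{..<M} \<times> {..<M}. c s * b2 s z)"
      "\<forall>z\<in>X \<times> X. g z = (\<Sum>s\<in>{..<M} \<times> {..<M}. e s * b2 s z)" by blast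
    then show ?case
      by (intro exI[of _ "\<lambda>s. c s + e s"]) (simp add: sum.distrib distrib_right)
  qed
  then show ?thesis by (intro spannedI[of "{..<M} \<times> {..<M}"]) auto
qed

text \<open>Monomials in x - y lie in the tensor square of the polynomials of degree at most D,
  whose restrictions to pairs from X are spanned by \<open>C\<^sup>2 * (D + 1) ^ (2 * k)\<close>
  functions. This reflects that the difference set is an image of a set of dimension 2 k.\<close>

lemma ex_dpoly_vanishing_on_differences:
  assumes "growth n X k" "2 * k < n"
  shows "\<exists>D F w. dpoly n D F \<and> (\<forall>x\<in>X. \<forall>y\<in>X. F (\<lambda>i. x i - y i) = 0) \<and> F w \<noteq> 0"
proof -
  obtain C where C: "\<And>D. spanned X (C * (D + 1) ^ k) {p. dpoly n D p}"
    using assms(1) by (auto simp: growth_def)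
  \<comment> \<open>The choice made in \<open>ex_hpoly_vanishing\<close>, with the square of C, 2 k
    for k and n for m.\<close>
  define E where "E = C\<^sup>2 * (n + 1) ^ (2 * k)"
  define D where "D = n * E"
  define f where "f \<alpha> w = (\<Prod>i<n. w i ^ \<alpha> i)" for \<alpha> :: "nat \<Rightarrow> nat" and w :: "nat \<Rightarrow> complex"
  have f: "dpoly n D (f \<alpha>)" if "\<alpha> \<in> exponents n E" for \<alpha>
    using dpoly_mono[OF hpoly_imp_dpoly[OF hpoly_monomial[OF order_refl]] sum_exponents_le[OF that]]
    by (simp add: f_def[abs_def] D_def)
  have "(C * (D + 1) ^ k) * (C * (D + 1) ^ k) = C\<^sup>2 * (D + 1) ^ (2 * k)"
    unfolding power2_eq_square mult_2 power_add by (simp only: mult_ac)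
  also have "\<dots> \<le> C\<^sup>2 * ((n + 1) * (E + 1)) ^ (2 * k)"
    by (intro mult_le_mono2 power_mono) (auto simp: D_def)
  also have "\<dots> = E * (E + 1) ^ (2 * k)" by (simp only: E_def power_mult_distrib mult.assoc)
  also have "\<dots> < (E + 1) ^ Suc (2 * k)" by simp
  also have "\<dots> \<le> (E + 1) ^ n" using assms(2) by (intro power_increasing) auto
  finally have card: "(C * (D + 1) ^ k) * (C * (D + 1) ^ k) < card (exponents n E)"
    by (simp add: card_exponents)
  have "\<exists>c. (\<exists>\<alpha>\<in>exponents n E. c \<alpha> \<noteq> 0) \<and> (\<forall>z\<in>X \<times> X.
      (\<Sum>\<alpha>\<in>exponents n E. c \<alpha> * (\<lambda>z. f \<alpha> (\<lambda>i. fst z i - snd z i)) z) = 0)"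
    using dpoly_diff_bipoly f
    by (intro spanned_dependent[OF spanned_bipoly[OF C] finite_exponents card]) auto
  then obtain c where c: "\<exists>\<alpha>\<in>exponents n E. c \<alpha> \<noteq> 0"
      "\<forall>x\<in>X. \<forall>y\<in>X. (\<Sum>\<alpha>\<in>exponents n E. c \<alpha> * f \<alpha> (\<lambda>i. x i - y i)) = 0" by auto
  obtain w where "(\<Sum>\<alpha>\<in>exponents n E. c \<alpha> * f \<alpha> w) \<noteq> 0"
    using monomials_independent[of c n E] c(1) unfolding f_def by blast
  moreover have "dpoly n D (\<lambda>x. \<Sum>\<alpha>\<in>exponents n E. c \<alpha> * f \<alpha> x)"
    by (intro dpoly_sum dpoly_cmult f)
  ultimately show ?thesis using c(2) by blast
qed

section \<open>Bi-Lipschitz estimates for a projection\<close>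

text \<open>For s \<noteq> 0 the sum is that of the forms of degrees m to D at s times the point (u
  + z, 1), divided by s^m. At s = 0 and z = 0 it is the form of degree m at the direction, so
  continuity gives \<open>\<epsilon>\<close>.\<close>

lemma nonvanishing_near_direction:
  assumes h: "\<And>j. hpoly (Suc n) j (h j)" and m: "m \<le> D" "h m (lift n u origin 1) \<noteq> 0"
  shows "\<exists>\<epsilon>>0. \<forall>z s. cmod s < \<epsilon> \<and> (\<forall>i<n. cmod (z i) < \<epsilon>) \<longrightarrow>
           (\<Sum>j=m..D. s ^ (j - m) * h j (lift n u z 1)) \<noteq> 0"
proof (rule ccontr)
  assume neg: "\<not> ?thesis"
  have "\<forall>k. \<exists>zs. cmod (snd zs) < 1 / real (Suc k) \<and> (\<forall>i<n. cmod (fst zs i) < 1 / real (Suc k)) \<and>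
      (\<Sum>j=m..D. snd zs ^ (j - m) * h j (lift n u (fst zs) 1)) = 0"
  proof
    fix k
    have "0 < 1 / real (Suc k)" by simp
    then obtain z s where "cmod s < 1 / real (Suc k)" "\<forall>i<n. cmod (z i) < 1 / real (Suc k)"
        "(\<Sum>j=m..D. s ^ (j - m) * h j (lift n u z 1)) = 0"
      using neg by blast
    then show "\<exists>zs. cmod (snd zs) < 1 / real (Suc k) \<and> (\<forall>i<n. cmod (fst zs i) < 1 / real (Suc k)) \<and>
      (\<Sum>j=m..D. snd zs ^ (j - m) * h j (lift n u (fst zs) 1)) = 0"
      by (intro exI[of _ "(z, s)"]) simp
  qed
  from choice[OF this] obtain f where f: "\<And>k. cmod (snd (f k)) < 1 / real (Suc k)"
    "\<And>k i. i < n \<Longrightarrow> cmod (fst (f k) i) < 1 / real (Suc k)"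
    "\<And>k. (\<Sum>j=m..D. snd (f k) ^ (j - m) * h j (lift n u (fst (f k)) 1)) = 0"
    by blast
  have s: "(\<lambda>k. snd (f k)) \<longlonglongrightarrow> 0"
    by (rule Lim_null_comparison[OF _ LIMSEQ_inverse_real_of_nat])
       (use f(1) in \<open>auto intro!: always_eventually less_imp_le simp: inverse_eq_divide\<close>)
  have z: "(\<lambda>k. fst (f k) i) \<longlonglongrightarrow> 0" if "i < n" for i
    by (rule Lim_null_comparison[OF _ LIMSEQ_inverse_real_of_nat])
       (use f(2)[OF that] in \<open>auto intro!: always_eventually less_imp_le simp: inverse_eq_divide\<close>)
  have "(\<lambda>k. lift n u (fst (f k)) 1 i) \<longlonglongrightarrow> lift n u origin 1 i" for i
  proof (cases "i < n")
    case True
    then show ?thesis using tendsto_add[OF z[OF True] tendsto_const[of "u i"]] by (simp add: lift_def)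
  qed (simp add: lift_def)
  then have "(\<lambda>k. h j (lift n u (fst (f k)) 1)) \<longlonglongrightarrow> h j (lift n u origin 1)" for j
    by (intro cpoly_tendsto[OF hpoly_imp_cpoly[OF h]])
  then have "(\<lambda>k. \<Sum>j=m..D. snd (f k) ^ (j - m) * h j (lift n u (fst (f k)) 1))
      \<longlonglongrightarrow> (\<Sum>j=m..D. 0 ^ (j - m) * h j (lift n u origin 1))"
    by (intro tendsto_sum tendsto_mult tendsto_power s)
  \<comment> \<open>Since 0^0 = 1, exactly the term j = m survives.\<close>
  moreover have "(\<Sum>j=m..D. 0 ^ (j - m) * h j (lift n u origin 1))
      = (\<Sum>j=m..D. if j = m then h m (lift n u origin 1) else 0)"
    by (intro sum.cong) auto
  ultimately have "(\<lambda>k. 0 :: complex) \<longlonglongrightarrow> h m (lift n u origin 1)"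
    using f(3) m(1) by simp
  then show False using m(2) LIMSEQ_unique tendsto_const by blast
qed

text \<open>A zero w violating the bound would be \<open>w n\<close> times
  \<open>lift n u z 1\<close> with small z, where the sum of the forms is \<open>w n ^ m\<close>
  times a nonzero factor. Thus the zero set avoids a cone around the direction near the
  origin.\<close>

lemma last_coordinate_bound:
  assumes h: "\<And>j. hpoly (Suc n) j (h j)" and m: "m \<le> D" "h m (lift n u origin 1) \<noteq> 0"
    and low: "\<And>j x. j < m \<Longrightarrow> h j x = 0"
  shows "\<exists>\<epsilon>>0. \<forall>w. (\<Sum>j\<le>D. h j w) = 0 \<and> cmod (w n) < \<epsilon> \<and> w n \<noteq> 0 \<longrightarrow>
           (\<exists>i<n. \<epsilon> * cmod (w n) \<le> cmod (proj n u w i))"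
proof -
  obtain \<epsilon> where \<epsilon>: "\<epsilon> > 0" "\<And>z s. cmod s < \<epsilon> \<Longrightarrow> (\<And>i. i < n \<Longrightarrow> cmod (z i) < \<epsilon>) \<Longrightarrow>
      (\<Sum>j=m..D. s ^ (j - m) * h j (lift n u z 1)) \<noteq> 0"
    using nonvanishing_near_direction[where h = h, OF h m] by blast
  have "\<exists>i<n. \<epsilon> * cmod (w n) \<le> cmod (proj n u w i)"
    if w: "(\<Sum>j\<le>D. h j w) = 0" "cmod (w n) < \<epsilon>" "w n \<noteq> 0" for w
  proof (rule ccontr)
    assume neg: "\<not> ?thesis"
    define z where "z i = proj n u w i / w n" for i
    have "cmod (z i) < \<epsilon>" if "i < n" for i
      using neg that w(3) by (auto simp: z_def norm_divide divide_less_eq not_le)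
    then have nz: "(\<Sum>j=m..D. w n ^ (j - m) * h j (lift n u z 1)) \<noteq> 0"
      using \<epsilon>(2) w(2) by blast
    have hw: "h j w = w n ^ j * h j (lift n u z 1)" for j
    proof -
      have "h j w = h j (\<lambda>i. w n * lift n u z 1 i)"
        by (rule cpoly_cong[OF hpoly_imp_cpoly[OF h]])
           (use w(3) in \<open>auto simp: lift_def z_def proj_def less_Suc_eq field_simps\<close>)
      then show ?thesis using hpoly_scale[OF h] by simp
    qed
    have "(\<Sum>j\<le>D. h j w) = (\<Sum>j=m..D. h j w)"
      using low m(1) by (intro sum.mono_neutral_right) auto
    also have "\<dots> = w n ^ m * (\<Sum>j=m..D. w n ^ (j - m) * h j (lift n u z 1))"
      unfolding sum_distrib_left
    proof (intro sum.cong refl)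
      fix j assume "j \<in> {m..D}"
      then have "w n ^ j = w n ^ m * w n ^ (j - m)" by (simp add: power_add[symmetric])
      then show "h j w = w n ^ m * (w n ^ (j - m) * h j (lift n u z 1))" by (simp add: hw mult.assoc)
    qed
    finally show False using w(1,3) nz by simp
  qed
  then show ?thesis using \<epsilon>(1) by blast
qed

text \<open>The zero set of a form is invariant under scaling, so the smallness of
  \<open>w n\<close> can always be arranged.\<close>

lemma last_coordinate_bound_homogeneous:
  assumes G: "hpoly (Suc n) D G" "G (lift n u origin 1) \<noteq> 0"
  shows "\<exists>\<epsilon>>0. \<forall>w. G w = 0 \<and> w n \<noteq> 0 \<longrightarrow> (\<exists>i<n. \<epsilon> * cmod (w n) \<le> cmod (proj n u w i))"
proof -
  define h where "h j = (if j = D then G else (\<lambda>_. 0))" for j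
  have h: "hpoly (Suc n) j (h j)" for j using G(1) by (auto simp: h_def intro: hpoly.zero)
  obtain \<epsilon> where \<epsilon>: "\<epsilon> > 0" "\<And>w. (\<Sum>j\<le>D. h j w) = 0 \<Longrightarrow> cmod (w n) < \<epsilon> \<Longrightarrow> w n \<noteq> 0 \<Longrightarrow>
      \<exists>i<n. \<epsilon> * cmod (w n) \<le> cmod (proj n u w i)"
    using last_coordinate_bound[where h = h and m = D and D = D and u = u, OF h] G(2)
    by (auto simp: h_def)
  have "\<exists>i<n. \<epsilon> * cmod (w n) \<le> cmod (proj n u w i)" if w: "G w = 0" "w n \<noteq> 0" for w
  proof -
    \<comment> \<open>Scales the last coordinate to modulus \<open>\<epsilon> / 2\<close>, inside
      the range of the local bound.\<close>
    define s where "s = complex_of_real (\<epsilon> / (2 * cmod (w n)))"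
    have s: "cmod s * cmod (w n) = \<epsilon> / 2" "s \<noteq> 0"
      using \<epsilon>(1) w(2) by (auto simp: s_def norm_divide norm_mult)
    have "(\<Sum>j\<le>D. h j (\<lambda>i. s * w i)) = (\<Sum>j\<le>D. if j = D then G (\<lambda>i. s * w i) else 0)"
      by (intro sum.cong) (auto simp: h_def)
    also have "\<dots> = 0" using hpoly_scale[OF G(1)] w(1) by simp
    finally obtain i where i: "i < n" "\<epsilon> * cmod (s * w n) \<le> cmod (proj n u (\<lambda>i. s * w i) i)"
      using \<epsilon>(2)[of "\<lambda>i. s * w i"] s \<epsilon>(1) w(2) by (auto simp: norm_mult)
    have "proj n u (\<lambda>i. s * w i) i = s * proj n u w i"
      by (simp add: proj_def algebra_simps)
    then have "cmod s * (\<epsilon> * cmod (w n)) \<le> cmod s * cmod (proj n u w i)"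
      using i(2) by (simp add: norm_mult algebra_simps)
    then show ?thesis using s(2) i(1) by auto
  qed
  then show ?thesis using \<epsilon>(1) by blast
qed

section \<open>Lipschitz constants of the projection and of its inverse\<close>

lemma cmod_le_cdist: "i < n \<Longrightarrow> cmod (x i - y i) \<le> cdist n x y"
  unfolding cdist_def by (intro member_le_L2_set) auto

lemma cdist_le_sum: "cdist n x y \<le> (\<Sum>i<n. cmod (x i - y i))"
  unfolding cdist_def by (rule L2_set_le_sum) auto

lemma cdist_nonneg: "0 \<le> cdist n x y"
  by (simp add: cdist_def)

lemma proj_diff: "proj n u (\<lambda>i. x i - y i) i = proj n u x i - proj n u y i"
  by (simp add: proj_def algebra_simps)

lemma proj_Lipschitz:
  "\<exists>L>0. \<forall>x y. cdist n (proj n u x) (proj n u y) \<le> L * cdist (Suc n) x y"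
proof -
  define S where "S = (\<Sum>i<n. 1 + cmod (u i))"
  \<comment> \<open>For n = 0 the sum S is 0; adding 1 makes the constant positive.\<close>
  have "cdist n (proj n u x) (proj n u y) \<le> (S + 1) * cdist (Suc n) x y" for x y
  proof -
    have "cdist n (proj n u x) (proj n u y) \<le> (\<Sum>i<n. cmod (proj n u x i - proj n u y i))"
      by (rule cdist_le_sum)
    also have "\<dots> \<le> (\<Sum>i<n. (1 + cmod (u i)) * cdist (Suc n) x y)"
    proof (rule sum_mono)
      fix i assume "i \<in> {..<n}"
      then have i: "i < n" by simp
      have "proj n u x i - proj n u y i = (x i - y i) - (x n - y n) * u i"
        using i by (simp add: proj_def algebra_simps)
      then have "cmod (proj n u x i - proj n u y i) \<le> cmod (x i - y i) + cmod (x n - y n) * cmod (u i)"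
        using norm_triangle_ineq4[of "x i - y i" "(x n - y n) * u i"] by (simp add: norm_mult)
      also have "\<dots> \<le> cdist (Suc n) x y + cdist (Suc n) x y * cmod (u i)"
        using i by (intro add_mono mult_right_mono cmod_le_cdist) auto
      finally show "cmod (proj n u x i - proj n u y i) \<le> (1 + cmod (u i)) * cdist (Suc n) x y"
        by (simp add: algebra_simps)
    qed
    also have "\<dots> = S * cdist (Suc n) x y" by (simp add: S_def sum_distrib_right)
    finally show ?thesis using cdist_nonneg[of "Suc n" x y] by (simp add: algebra_simps)
  qed
  moreover have "S \<ge> 0" unfolding S_def by (intro sum_nonneg) simp
  ultimately show ?thesis by (intro exI[of _ "S + 1"]) auto
qed

text \<open>The hypothesis bounds the last coordinate of x - y by the projected difference; each
  other coordinate is the projected one plus u i times the last one.\<close>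

lemma proj_expansive:
  assumes "\<epsilon> > 0"
  shows "\<exists>K>0. \<forall>x y. (x n \<noteq> y n \<longrightarrow>
      (\<exists>i<n. \<epsilon> * cmod (x n - y n) \<le> cmod (proj n u x i - proj n u y i))) \<longrightarrow>
      cdist (Suc n) x y \<le> K * cdist n (proj n u x) (proj n u y)"
proof -
  define S where "S = (\<Sum>i<n. cmod (u i))"
  have S: "S \<ge> 0" unfolding S_def by (intro sum_nonneg) simp
  \<comment> \<open>The summand n accounts for the projected coordinates, S /
    \<open>\<epsilon>\<close> for the multiples u i of the last coordinate and 1 /
    \<open>\<epsilon>\<close> for the last coordinate itself.\<close>
  define K where "K = real n + (S + 1) / \<epsilon>"
  have "cdist (Suc n) x y \<le> K * cdist n (proj n u x) (proj n u y)"
    if xy: "x n \<noteq> y n \<longrightarrow> (\<exists>i<n. \<epsilon> * cmod (x n - y n) \<le> cmod (proj n u x i - proj n u y i))"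
    for x y
  proof -
    define \<delta> where "\<delta> = cdist n (proj n u x) (proj n u y)"
    have \<delta>: "cmod (proj n u x i - proj n u y i) \<le> \<delta>" if "i < n" for i
      unfolding \<delta>_def using that by (rule cmod_le_cdist)
    have last: "cmod (x n - y n) \<le> \<delta> / \<epsilon>"
    proof (cases "x n = y n")
      case True
      then show ?thesis using assms cdist_nonneg by (simp add: \<delta>_def)
    next
      case False
      then obtain i where "i < n" "\<epsilon> * cmod (x n - y n) \<le> cmod (proj n u x i - proj n u y i)"
        using xy by blast
      then have "\<epsilon> * cmod (x n - y n) \<le> \<delta>" using \<delta> by (meson order_trans)
      then show ?thesis using assms by (simp add: field_simps)
    qed
    have "cdist (Suc n) x y \<le> (\<Sum>i<n. cmod (x i - y i)) + cmod (x n - y n)"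
      using cdist_le_sum[of "Suc n" x y] by simp
    also have "(\<Sum>i<n. cmod (x i - y i)) \<le> (\<Sum>i<n. \<delta> + cmod (u i) * (\<delta> / \<epsilon>))"
    proof (rule sum_mono)
      fix i assume "i \<in> {..<n}"
      then have i: "i < n" by simp
      have "x i - y i = (proj n u x i - proj n u y i) + u i * (x n - y n)"
        using i by (simp add: proj_def algebra_simps)
      then have "cmod (x i - y i) \<le> cmod (proj n u x i - proj n u y i) + cmod (u i) * cmod (x n - y n)"
        using norm_triangle_ineq[of "proj n u x i - proj n u y i" "u i * (x n - y n)"]
        by (simp add: norm_mult)
      also have "\<dots> \<le> \<delta> + cmod (u i) * (\<delta> / \<epsilon>)"
        using \<delta>[OF i] last by (intro add_mono mult_left_mono) auto
      finally show "cmod (x i - y i) \<le> \<delta> + cmod (u i) * (\<delta> / \<epsilon>)" .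
    qed
    also have "\<dots> = real n * \<delta> + S * (\<delta> / \<epsilon>)"
      by (simp add: S_def sum.distrib sum_distrib_right sum_divide_distrib)
    finally have "cdist (Suc n) x y \<le> real n * \<delta> + S * (\<delta> / \<epsilon>) + \<delta> / \<epsilon>" using last by linarith
    also have "\<dots> = K * \<delta>" using assms by (simp add: K_def field_simps)
    finally show ?thesis by (simp add: \<delta>_def)
  qed
  moreover have "K > 0" using assms S by (auto simp: K_def intro!: add_nonneg_pos divide_pos_pos)
  ultimately show ?thesis by blast
qed

text \<open>The properties of a projection \<open>f\<close> that are accumulated while the last coordinates are
  eliminated one by one; the global estimate of the norm makes the germ of \<open>f ` X\<close> at the origin
  depend on the germ of \<open>X\<close> only.\<close>

definition good_projection ::
    "nat \<Rightarrow> (nat \<Rightarrow> complex) set \<Rightarrow> nat \<Rightarrow> ((nat \<Rightarrow> complex) \<Rightarrow> nat \<Rightarrow> complex) \<Rightarrow> bool" where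
  "good_projection n X m f \<longleftrightarrow>
     (\<forall>i<m. cpoly n (\<lambda>x. f x i)) \<and> (\<forall>x\<in>cspace n. f x \<in> cspace m) \<and> f origin = origin \<and>
     (\<exists>L>0. \<forall>x\<in>cspace n. \<forall>y\<in>cspace n. cdist m (f x) (f y) \<le> L * cdist n x y) \<and>
     algebraic_set m (f ` X) \<and>
     (\<exists>K>0. \<forall>x\<in>X. cdist n x origin \<le> K * cdist m (f x) origin) \<and>
     (\<exists>K>0. \<exists>r>0. \<forall>x\<in>X. \<forall>y\<in>X. cdist n x origin < r \<and> cdist n y origin < r \<longrightarrow>
        cdist n x y \<le> K * cdist m (f x) (f y))"

lemma good_projectionI:
  assumes "\<And>i. i < m \<Longrightarrow> cpoly n (\<lambda>x. f x i)" "\<And>x. x \<in> cspace n \<Longrightarrow> f x \<in> cspace m"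
    "f origin = origin" "algebraic_set m (f ` X)"
    "L > 0" "\<And>x y. x \<in> cspace n \<Longrightarrow> y \<in> cspace n \<Longrightarrow> cdist m (f x) (f y) \<le> L * cdist n x y"
    "K > 0" "\<And>x. x \<in> X \<Longrightarrow> cdist n x origin \<le> K * cdist m (f x) origin"
    "M > 0" "r > 0" "\<And>x y. x \<in> X \<Longrightarrow> y \<in> X \<Longrightarrow> cdist n x origin < r \<Longrightarrow> cdist n y origin < r \<Longrightarrow>
        cdist n x y \<le> M * cdist m (f x) (f y)"
  shows "good_projection n X m f"
  unfolding good_projection_def using assms
  by (intro conjI exI[of _ L] exI[of _ K] exI[of _ M] exI[of _ r]) simp_all

lemma good_projectionE:
  assumes "good_projection n X m f"
  obtains L K M r where "L > 0"
    "\<And>x y. x \<in> cspace n \<Longrightarrow> y \<in> cspace n \<Longrightarrow> cdist m (f x) (f y) \<le> L * cdist n x y"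
    "K > 0" "\<And>x. x \<in> X \<Longrightarrow> cdist n x origin \<le> K * cdist m (f x) origin"
    "M > 0" "r > 0" "\<And>x y. x \<in> X \<Longrightarrow> y \<in> X \<Longrightarrow> cdist n x origin < r \<Longrightarrow> cdist n y origin < r \<Longrightarrow>
        cdist n x y \<le> M * cdist m (f x) (f y)"
proof -
  have "\<exists>L>0. \<forall>x\<in>cspace n. \<forall>y\<in>cspace n. cdist m (f x) (f y) \<le> L * cdist n x y"
    using assms by (simp only: good_projection_def)
  then obtain L where L: "L > 0"
    "\<forall>x\<in>cspace n. \<forall>y\<in>cspace n. cdist m (f x) (f y) \<le> L * cdist n x y" by blast
  have "\<exists>K>0. \<forall>x\<in>X. cdist n x origin \<le> K * cdist m (f x) origin"
    using assms by (simp only: good_projection_def)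
  then obtain K where K: "K > 0" "\<forall>x\<in>X. cdist n x origin \<le> K * cdist m (f x) origin" by blast
  have "\<exists>K>0. \<exists>r>0. \<forall>x\<in>X. \<forall>y\<in>X. cdist n x origin < r \<and> cdist n y origin < r \<longrightarrow>
        cdist n x y \<le> K * cdist m (f x) (f y)"
    using assms by (simp only: good_projection_def)
  then obtain M r where M: "M > 0" "r > 0"
    "\<forall>x\<in>X. \<forall>y\<in>X. cdist n x origin < r \<and> cdist n y origin < r \<longrightarrow>
        cdist n x y \<le> M * cdist m (f x) (f y)" by blast
  show ?thesis
    by (rule that[OF L(1) _ K(1) _ M(1,2)]) (use L(2) K(2) M(3) in auto)
qed

section \<open>Composition and existence of good projections\<close>

lemma origin_in_cspace: "origin \<in> cspace n"
  by (simp add: cspace_def)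

lemma algebraic_set_mono:
  assumes "algebraic_set n X" "n \<le> m"
  shows "algebraic_set m X"
proof -
  obtain P where P: "\<forall>p\<in>P. cpoly n p" "X = {x \<in> cspace n. \<forall>p\<in>P. p x = 0}"
    using assms(1) unfolding algebraic_set_def by blast
  have "algebraic_set m {x \<in> cspace m. \<forall>p\<in>P. p x = 0}"
    unfolding algebraic_set_def using P(1) assms(2) by (intro exI[of _ P]) (auto intro: cpoly_mono)
  from algebraic_set_Int[OF algebraic_set_cspace[OF assms(2)] this] show ?thesis
  proof (rule back_subst[of "algebraic_set m"])
    show "cspace n \<inter> {x \<in> cspace m. \<forall>p\<in>P. p x = 0} = X"
      using assms(2) by (auto simp: P(2) cspace_def)
  qed
qed

text \<open>Handles ambient dimensions that are already at most 2 k. Coordinates from n on are set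
  to 0 explicitly because \<open>cpoly n\<close> only knows the first n.\<close>

lemma good_projection_inclusion:
  assumes "algebraic_set n X" "n \<le> m"
  shows "good_projection n X m (\<lambda>x i. if i < n then x i else 0)"
proof -
  define f where "f x i = (if i < n then x i else 0)" for x :: "nat \<Rightarrow> complex" and i
  have f: "f x = x" if "x \<in> cspace n" for x
    using that by (auto simp: f_def cspace_def fun_eq_iff)
  have d: "cdist m x y = cdist n x y" if "x \<in> cspace n" "y \<in> cspace n" for x y
    unfolding cdist_def L2_set_def using assms(2) that
    by (intro arg_cong[of _ _ sqrt] sum.mono_neutral_right) (auto simp: cspace_def)
  have X: "X \<subseteq> cspace n" using assms(1) by (rule algebraic_set_subset)
  have "f ` X = X" using f X by force
  then have "algebraic_set m (f ` X)" using algebraic_set_mono[OF assms] by simp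
  moreover have "cpoly n (\<lambda>x. f x i)" for i
    by (cases "i < n") (auto simp: f_def intro: cpoly.intros)
  moreover have "\<forall>x\<in>cspace n. f x \<in> cspace m" using assms(2) by (auto simp: f_def cspace_def)
  moreover have "f origin = origin" by (simp add: f_def fun_eq_iff)
  moreover have "cdist m (f x) (f y) = cdist n x y" if "x \<in> cspace n" "y \<in> cspace n" for x y
    using f d that by simp
  ultimately have "good_projection n X m f"
    using X origin_in_cspace[of n] f
    by (intro good_projectionI[where L = 1 and K = 1 and M = 1 and r = 1]) (auto simp: d subset_iff)
  then show ?thesis by (simp add: f_def[abs_def])
qed

lemma good_projection_compose:
  assumes g: "good_projection n X m g" and f: "good_projection m (g ` X) l f"
    and X: "X \<subseteq> cspace n"
  shows "good_projection n X l (\<lambda>x. f (g x))"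
proof -
  obtain L1 K1 K3 r1 where L1: "L1 > 0"
      "\<And>x y. x \<in> cspace n \<Longrightarrow> y \<in> cspace n \<Longrightarrow> cdist m (g x) (g y) \<le> L1 * cdist n x y"
    and K1: "K1 > 0" "\<And>x. x \<in> X \<Longrightarrow> cdist n x origin \<le> K1 * cdist m (g x) origin"
    and r1: "K3 > 0" "r1 > 0"
      "\<And>x y. x \<in> X \<Longrightarrow> y \<in> X \<Longrightarrow> cdist n x origin < r1 \<Longrightarrow> cdist n y origin < r1 \<Longrightarrow>
        cdist n x y \<le> K3 * cdist m (g x) (g y)"
    by (rule good_projectionE[OF g], rule that, assumption+)
  obtain L2 K2 K4 r2 where L2: "L2 > 0"
      "\<And>x y. x \<in> cspace m \<Longrightarrow> y \<in> cspace m \<Longrightarrow> cdist l (f x) (f y) \<le> L2 * cdist m x y"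
    and K2: "K2 > 0" "\<And>x. x \<in> g ` X \<Longrightarrow> cdist m x origin \<le> K2 * cdist l (f x) origin"
    and r2: "K4 > 0" "r2 > 0"
      "\<And>x y. x \<in> g ` X \<Longrightarrow> y \<in> g ` X \<Longrightarrow> cdist m x origin < r2 \<Longrightarrow> cdist m y origin < r2 \<Longrightarrow>
        cdist m x y \<le> K4 * cdist l (f x) (f y)"
    by (rule good_projectionE[OF f], rule that, assumption+)
  have g0: "g origin = origin" "\<And>x. x \<in> cspace n \<Longrightarrow> g x \<in> cspace m"
    and f0: "f origin = origin" "\<And>x. x \<in> cspace m \<Longrightarrow> f x \<in> cspace l"
    using g f by (auto simp: good_projection_def)
  have "cpoly n (\<lambda>x. f (g x) i)" if "i < l" for i
    using cpoly_subst[of m "\<lambda>y. f y i" n g] f g that by (simp add: good_projection_def)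
  moreover have "cdist l (f (g x)) (f (g y)) \<le> (L2 * L1) * cdist n x y"
    if "x \<in> cspace n" "y \<in> cspace n" for x y
  proof -
    have "cdist l (f (g x)) (f (g y)) \<le> L2 * cdist m (g x) (g y)" using that by (intro L2 g0)
    also have "\<dots> \<le> L2 * (L1 * cdist n x y)" using L1 L2(1) that by (intro mult_left_mono) auto
    finally show ?thesis by (simp add: mult.assoc)
  qed
  moreover have "cdist n x origin \<le> (K1 * K2) * cdist l (f (g x)) origin" if "x \<in> X" for x
  proof -
    have "cdist n x origin \<le> K1 * cdist m (g x) origin" using that by (rule K1)
    also have "\<dots> \<le> K1 * (K2 * cdist l (f (g x)) origin)"
      using K1(1) K2(2)[OF imageI[OF that]] by (intro mult_left_mono) auto
    finally show ?thesis by (simp add: mult.assoc)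
  qed
  \<comment> \<open>The bound r1 serves g, and r2 / L1 makes g map the ball into the ball of radius
    r2 on which f is controlled.\<close>
  moreover define r where "r = min r1 (r2 / L1)"
  have "cdist n x y \<le> (K3 * K4) * cdist l (f (g x)) (f (g y))"
    if xy: "x \<in> X" "y \<in> X" "cdist n x origin < r" "cdist n y origin < r" for x y
  proof -
    have small: "cdist m (g z) origin < r2" if "z \<in> X" "cdist n z origin < r" for z
    proof -
      have "cdist m (g z) origin \<le> L1 * cdist n z origin"
        using L1(2)[of z origin] that(1) X origin_in_cspace g0(1) by auto
      also have "\<dots> < r2" using that(2) L1(1) by (simp add: r_def field_simps)
      finally show ?thesis .
    qed
    have "cdist n x y \<le> K3 * cdist m (g x) (g y)" using xy by (intro r1) (auto simp: r_def)
    also have "\<dots> \<le> K3 * (K4 * cdist l (f (g x)) (f (g y)))"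
      using xy small r1(1) by (intro mult_left_mono r2) auto
    finally show ?thesis by (simp add: mult.assoc)
  qed
  moreover have "r > 0" using r1(2) r2(2) L1(1) by (simp add: r_def)
  moreover have "algebraic_set l ((\<lambda>x. f (g x)) ` X)"
    using f by (simp add: good_projection_def image_image)
  moreover have "L2 * L1 > 0" "K1 * K2 > 0" "K3 * K4 > 0" using L1 L2 K1 K2 r1 r2 by auto
  ultimately show ?thesis
    using f0 g0 by (intro good_projectionI[where L = "L2 * L1" and K = "K1 * K2" and M = "K3 * K4" and r = r])
      simp_all
qed

lemma proj_origin: "proj n u origin = origin"
  by (simp add: proj_def fun_eq_iff)

lemma ex_good_proj:
  assumes X: "algebraic_set (Suc n) X" "origin \<in> X" and k: "growth (Suc n) X k" "1 \<le> k" "2 * k \<le> n"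
  shows "\<exists>u. good_projection (Suc n) X n (proj n u)"
proof -
  obtain d G a where G: "hpoly (Suc n) d G" "\<And>x. x \<in> X \<Longrightarrow> G x = 0" "G a \<noteq> 0"
    \<comment> \<open>1 <= k and 2 k <= n give k < n, as the homogeneous count requires.\<close>
    using ex_hpoly_vanishing[OF k(1)] k(2,3) by auto
  obtain D F b where F: "dpoly (Suc n) D F"
      "\<And>x y. x \<in> X \<Longrightarrow> y \<in> X \<Longrightarrow> F (\<lambda>i. x i - y i) = 0" "F b \<noteq> 0"
    using ex_dpoly_vanishing_on_differences[OF k(1)] k(3) by auto
  obtain h where h: "\<And>j. hpoly (Suc n) j (h j)" "\<And>x. F x = (\<Sum>j\<le>D. h j x)"
    using dpoly_homogeneous_parts[OF F(1)] by blast
  have "\<exists>j\<in>{..D}. h j b \<noteq> 0"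
    using F(3) h(2)[of b] sum.not_neutral_contains_not_neutral by metis
  then obtain j where j: "j \<le> D" "h j b \<noteq> 0" by auto
  \<comment> \<open>The degree of the lowest nonzero form of F, whose zeros form the tangent cone at
    the origin of the zero set of F.\<close>
  define m where "m = (LEAST j. \<exists>x. h j x \<noteq> 0)"
  have "\<exists>x. h m x \<noteq> 0" unfolding m_def using j(2) by (intro LeastI) blast
  then obtain c where c: "h m c \<noteq> 0" by blast
  have low: "h i x = 0" if "i < m" for i x using not_less_Least[of i "\<lambda>j. \<exists>x. h j x \<noteq> 0"] that
    unfolding m_def by blast
  have m: "m \<le> D" using low[of j b] j by (meson leI le_trans)
  obtain u where u: "G (lift n u origin 1) \<noteq> 0" "h m (lift n u origin 1) \<noteq> 0"
    using ex_direction[OF G(1) h(1) G(3) c] by blast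
  obtain \<epsilon> where \<epsilon>: "\<epsilon> > 0" "\<And>w. G w = 0 \<Longrightarrow> w n \<noteq> 0 \<Longrightarrow> \<exists>i<n. \<epsilon> * cmod (w n) \<le> cmod (proj n u w i)"
    using last_coordinate_bound_homogeneous[OF G(1) u(1)] by blast
  obtain \<delta> where \<delta>: "\<delta> > 0" "\<And>w. F w = 0 \<Longrightarrow> cmod (w n) < \<delta> \<Longrightarrow> w n \<noteq> 0 \<Longrightarrow>
      \<exists>i<n. \<delta> * cmod (w n) \<le> cmod (proj n u w i)"
    using last_coordinate_bound[where h = h, OF h(1) m u(2) low] unfolding h(2)[symmetric] by blast
  obtain L where L: "L > 0" "\<And>x y. cdist n (proj n u x) (proj n u y) \<le> L * cdist (Suc n) x y"
    using proj_Lipschitz by blast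
  obtain K1 where K1: "K1 > 0" "\<And>x y. (x n \<noteq> y n \<Longrightarrow>
      (\<exists>i<n. \<epsilon> * cmod (x n - y n) \<le> cmod (proj n u x i - proj n u y i))) \<Longrightarrow>
      cdist (Suc n) x y \<le> K1 * cdist n (proj n u x) (proj n u y)"
    using proj_expansive[OF \<epsilon>(1), of n u] by blast
  obtain K2 where K2: "K2 > 0" "\<And>x y. (x n \<noteq> y n \<Longrightarrow>
      (\<exists>i<n. \<delta> * cmod (x n - y n) \<le> cmod (proj n u x i - proj n u y i))) \<Longrightarrow>
      cdist (Suc n) x y \<le> K2 * cdist n (proj n u x) (proj n u y)"
    using proj_expansive[OF \<delta>(1), of n u] by blast
  have fm: "finite_map (Suc n) X n (proj n u)"
  proof (rule finite_map_proj[where d = d and h = "\<lambda>j. if j = d then G else (\<lambda>_. 0)"])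
    show "hpoly (Suc n) j (if j = d then G else (\<lambda>_. 0))" for j
      using G(1) by (auto intro: hpoly.zero)
    show "(\<Sum>j\<le>d. (if j = d then G else (\<lambda>_. 0)) x) = 0" if "x \<in> X" for x
      using G(2)[OF that] by (intro sum.neutral) auto
  qed (use X(1) u(1) in auto)
  \<comment> \<open>G vanishes at x itself, the difference of x and the origin, so this pair
    satisfies the estimate for x of any size.\<close>
  have "cdist (Suc n) x origin \<le> K1 * cdist n (proj n u x) origin" if "x \<in> X" for x
    using K1(2)[of x origin] \<epsilon>(2)[of x] G(2)[OF that] by (simp add: proj_origin)
  \<comment> \<open>Half of \<open>\<delta>\<close> for each point keeps the last coordinate of the
    difference below \<open>\<delta>\<close>.\<close>
  moreover have "cdist (Suc n) x y \<le> K2 * cdist n (proj n u x) (proj n u y)"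
    if xy: "x \<in> X" "y \<in> X" "cdist (Suc n) x origin < \<delta> / 2 \<and> cdist (Suc n) y origin < \<delta> / 2" for x y
  proof (rule K2(2))
    assume "x n \<noteq> y n"
    moreover have "cmod (x n) < \<delta> / 2" "cmod (y n) < \<delta> / 2"
      using xy(3) cmod_le_cdist[of n "Suc n" x origin] cmod_le_cdist[of n "Suc n" y origin] by auto
    then have "cmod (x n - y n) < \<delta>" using norm_triangle_ineq4[of "x n" "y n"] by linarith
    ultimately show "\<exists>i<n. \<delta> * cmod (x n - y n) \<le> cmod (proj n u x i - proj n u y i)"
      using \<delta>(2)[of "\<lambda>i. x i - y i"] F(2)[OF xy(1,2)] by (simp add: proj_diff)
  qed
  moreover have "algebraic_set n (proj n u ` X)" "\<forall>i<n. cpoly (Suc n) (\<lambda>x. proj n u x i)"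
    using fm X(1) by (auto simp: finite_map_def)
  ultimately have "good_projection (Suc n) X n (proj n u)"
    using L K1(1) K2(1) \<delta>(1) proj_in_cspace proj_origin
    by (intro good_projectionI[where L = L and K = K1 and M = K2 and r = "\<delta> / 2"]) simp_all
  then show ?thesis by blast
qed

lemma ex_good_projection:
  assumes "algebraic_set n X" "origin \<in> X" "growth n X k" "1 \<le> k"
  shows "\<exists>f. good_projection n X (2 * k) f"
  using assms
proof (induction n arbitrary: X)
  case 0
  then show ?case using good_projection_inclusion[of 0 X] by blast
next
  case (Suc n)
  show ?case
  proof (cases "Suc n \<le> 2 * k")
    case True
    then show ?thesis using good_projection_inclusion[OF Suc.prems(1)] by blast
  next
    case False
    then obtain u where u: "good_projection (Suc n) X n (proj n u)"
      using ex_good_proj[OF Suc.prems] by auto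
    have "algebraic_set n (proj n u ` X)" using u by (simp only: good_projection_def)
    moreover have "origin \<in> proj n u ` X" using imageI[OF Suc.prems(2), of "proj n u"] by (simp only: proj_origin)
    moreover have "growth n (proj n u ` X) k" using growth_image[OF Suc.prems(3) dpoly_proj] .
    ultimately obtain f where "good_projection n (proj n u ` X) (2 * k) f"
      using Suc.IH[OF _ _ _ Suc.prems(4)] by blast
    from good_projection_compose[OF u this algebraic_set_subset[OF Suc.prems(1)]]
    show ?thesis by (rule exI[where x = "\<lambda>x. f (proj n u x)"])
  qed
qed

section \<open>Germs\<close>

lemma openin_ctop:
  "openin (ctop n) U \<longleftrightarrow>
     U \<subseteq> cspace n \<and> (\<forall>x\<in>U. \<exists>r>0. \<forall>y\<in>cspace n. cdist n x y < r \<longrightarrow> y \<in> U)"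
proof -
  interpret Metric_space "cspace n" "cdist n" by (rule Metric_space_cspace)
  have "mball x r \<subseteq> U \<longleftrightarrow> (\<forall>y\<in>cspace n. cdist n x y < r \<longrightarrow> y \<in> U)"
    if "U \<subseteq> cspace n" "x \<in> U" for x r
    using that by (auto simp: subset_iff)
  then show ?thesis
    unfolding cmetric_def mtopology_of openin_mtopology Ball_def[of U]
    by (intro conj_cong refl all_cong1 imp_cong ex_cong1) simp_all
qed

lemma openin_ctop_cspace: "openin (ctop n) (cspace n)"
  using openin_topspace[of "ctop n"] by simp

lemma cdist_self [simp]: "cdist n x x = 0"
  by (simp add: cdist_def L2_set_def)

lemma cdist_commute: "cdist n x y = cdist n y x"
  by (rule Metric_space.commute[OF Metric_space_cspace])

lemma cdist_triangle:
  "x \<in> cspace n \<Longrightarrow> y \<in> cspace n \<Longrightarrow> z \<in> cspace n \<Longrightarrow> cdist n x z \<le> cdist n x y + cdist n y z"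
  by (rule Metric_space.triangle[OF Metric_space_cspace])

lemma cdist_eq_0_iff: "x \<in> cspace n \<Longrightarrow> y \<in> cspace n \<Longrightarrow> cdist n x y = 0 \<longleftrightarrow> x = y"
  by (rule Metric_space.zero[OF Metric_space_cspace])

lemma openin_preimage_ball:
  assumes "\<And>x. x \<in> cspace n \<Longrightarrow> f x \<in> cspace m" "L > 0"
    and L: "\<And>x y. x \<in> cspace n \<Longrightarrow> y \<in> cspace n \<Longrightarrow> cdist m (f x) (f y) \<le> L * cdist n x y"
  shows "openin (ctop n) {x \<in> cspace n. cdist m (f x) origin < r}"
  unfolding openin_ctop
proof (intro conjI ballI)
  fix x assume x: "x \<in> {x \<in> cspace n. cdist m (f x) origin < r}"
  define \<delta> where "\<delta> = (r - cdist m (f x) origin) / L"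
  have "\<delta> > 0" using x assms(2) by (simp add: \<delta>_def)
  moreover have "cdist m (f y) origin < r" if y: "y \<in> cspace n" "cdist n x y < \<delta>" for y
  proof -
    have "cdist m (f y) origin \<le> cdist m (f y) (f x) + cdist m (f x) origin"
      using x y assms(1) origin_in_cspace by (intro cdist_triangle) auto
    also have "cdist m (f y) (f x) \<le> L * cdist n x y"
      using L[of y x] x y by (simp add: cdist_commute)
    also have "\<dots> < r - cdist m (f x) origin"
      using y(2) assms(2) by (simp add: \<delta>_def field_simps)
    finally show ?thesis by simp
  qed
  ultimately show "\<exists>\<delta>>0. \<forall>y\<in>cspace n. cdist n x y < \<delta> \<longrightarrow> y \<in> {x \<in> cspace n. cdist m (f x) origin < r}"
    by (intro exI[of _ \<delta>]) simp
qed (rule Collect_subset)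

lemma openin_ball_origin: "openin (ctop n) {x \<in> cspace n. cdist n x origin < r}"
  using openin_preimage_ball[of n "\<lambda>x. x" n 1 r] by simp

lemma algebraic_set_closedin:
  assumes "algebraic_set n X"
  shows "closedin (ctop n) X"
proof -
  interpret Metric_space "cspace n" "cdist n" by (rule Metric_space_cspace)
  obtain P where P: "\<forall>p\<in>P. cpoly n p" "X = {x \<in> cspace n. \<forall>p\<in>P. p x = 0}"
    using assms unfolding algebraic_set_def by blast
  have "l \<in> X" if \<sigma>: "range \<sigma> \<subseteq> X" "limitin mtopology \<sigma> l sequentially" for \<sigma> l
  proof -
    have l: "l \<in> cspace n" "\<And>e. e > 0 \<Longrightarrow> eventually (\<lambda>k. cdist n (\<sigma> k) l < e) sequentially"
      using \<sigma>(2) unfolding limitin_metric by (auto elim: eventually_mono)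
    have coord: "(\<lambda>k. \<sigma> k i) \<longlonglongrightarrow> l i" if "i < n" for i
      unfolding tendsto_iff
    proof (intro allI impI)
      fix e :: real assume "e > 0"
      from l(2)[OF this] show "eventually (\<lambda>k. dist (\<sigma> k i) (l i) < e) sequentially"
        by (rule eventually_mono) (use cmod_le_cdist[OF that] in \<open>auto simp: dist_norm intro: le_less_trans\<close>)
    qed
    have "p l = 0" if "p \<in> P" for p
    proof -
      have "cpoly n p" using P(1) that by blast
      from cpoly_tendsto[OF this coord] have "(\<lambda>k. p (\<sigma> k)) \<longlonglongrightarrow> p l" .
      moreover have "p (\<sigma> k) = 0" for k using \<sigma>(1) P(2) that by auto
      ultimately show ?thesis by (simp add: LIMSEQ_const_iff)
    qed
    then show ?thesis using l(1) P(2) by simp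
  qed
  then show ?thesis
    unfolding cmetric_def mtopology_of metric_closedin_iff_sequentially_closed
    using algebraic_set_subset[OF assms] by blast
qed

section \<open>Germ embeddings and regularity\<close>

lemma bilipschitz_onI:
  assumes A: "A \<subseteq> cspace N" and B: "B \<subseteq> cspace n" and f: "f ` A = B"
    and L: "\<And>x y. x \<in> A \<Longrightarrow> y \<in> A \<Longrightarrow> cdist n (f x) (f y) \<le> L * cdist N x y"
    and K: "\<And>x y. x \<in> A \<Longrightarrow> y \<in> A \<Longrightarrow> cdist N x y \<le> K * cdist n (f x) (f y)"
  shows "bilipschitz_on N n A B f"
proof -
  have inj: "inj_on f A"
  proof (rule inj_onI)
    fix x y assume xy: "x \<in> A" "y \<in> A" "f x = f y"
    then have "f x \<in> cspace n" using f B by auto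
    then have "cdist n (f x) (f y) = 0" using xy(3) cdist_eq_0_iff by simp
    then have "cdist N x y = 0" using K[OF xy(1,2)] cdist_nonneg[of N x y] by simp
    then show "x = y" using xy A cdist_eq_0_iff by blast
  qed
  have inv: "inv_into A f y \<in> A" "f (inv_into A f y) = y" if "y \<in> B" for y
    using that f by (auto simp: inv_into_into f_inv_into_f)
  have "Lipschitz_continuous_map (submetric (cmetric N) A) (submetric (cmetric n) B) f"
    unfolding Lipschitz_continuous_map_def using A B f L by (auto intro!: exI[of _ L])
  moreover have "cdist N (inv_into A f x) (inv_into A f y) \<le> K * cdist n x y"
    if "x \<in> B" "y \<in> B" for x y
    using K[OF inv(1)[OF that(1)] inv(1)[OF that(2)]] inv(2) that by simp
  then have "Lipschitz_continuous_map (submetric (cmetric n) B) (submetric (cmetric N) A) (inv_into A f)"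
    unfolding Lipschitz_continuous_map_def using A B inv(1) by (auto intro!: exI[of _ K])
  ultimately show ?thesis using inj f by (simp add: bilipschitz_on_def bij_betw_def)
qed

lemma algebraic_set_empty: "algebraic_set n {}"
  unfolding algebraic_set_def by (intro exI[of _ "{\<lambda>_. 1}"]) (auto intro: cpoly.const)

lemma regular_map_germ_polynomial:
  assumes "origin \<in> X" "\<And>x. x \<in> X \<Longrightarrow> f x \<in> cspace n" "\<And>i. i < n \<Longrightarrow> cpoly N (\<lambda>x. f x i)"
  shows "regular_map_germ N X n f"
proof -
  have "regular_at N X (\<lambda>z. f z i) x" if "x \<in> X" "i < n" for x i
    unfolding regular_at_def using that assms(3) algebraic_set_empty[of N]
    by (intro exI[of _ "{}"] exI[of _ "\<lambda>x. f x i"] exI[of _ "\<lambda>_. 1"]) (auto intro: cpoly.const)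
  then show ?thesis
    unfolding regular_map_germ_def using assms(1,2) algebraic_set_empty[of N]
    by (intro exI[of _ "{}"]) simp
qed

lemma same_germ_refl: "same_germ n A A"
  unfolding same_germ_def using openin_ctop_cspace origin_in_cspace
  by (intro exI[of _ "cspace n"]) simp

text \<open>U is the full preimage of the ball V, so f maps X \<inter> U onto all of the image
  inside V. A mere ball in the source could miss points of the image that come from far away. The
  global norm estimate and the radius r / K place X \<inter> U in the ball of radius r, where the
  lower estimate holds.\<close>

lemma good_projection_germ_embedding:
  assumes f: "good_projection N X n f" and X: "X \<subseteq> cspace N" "origin \<in> X"
  shows "bilipschitz_germ_embedding N X n f (f ` X)"
proof -
  obtain L K M r where L: "L > 0"
      "\<And>x y. x \<in> cspace N \<Longrightarrow> y \<in> cspace N \<Longrightarrow> cdist n (f x) (f y) \<le> L * cdist N x y"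
    and K: "K > 0" "\<And>x. x \<in> X \<Longrightarrow> cdist N x origin \<le> K * cdist n (f x) origin"
    and M: "M > 0" "r > 0"
      "\<And>x y. x \<in> X \<Longrightarrow> y \<in> X \<Longrightarrow> cdist N x origin < r \<Longrightarrow> cdist N y origin < r \<Longrightarrow>
        cdist N x y \<le> M * cdist n (f x) (f y)"
    by (rule good_projectionE[OF f], rule that, assumption+)
  have f0: "f origin = origin" "\<And>x. x \<in> cspace N \<Longrightarrow> f x \<in> cspace n" "algebraic_set n (f ` X)"
    using f by (auto simp: good_projection_def)
  define U where "U = {x \<in> cspace N. cdist n (f x) origin < r / K}"
  define V where "V = {x \<in> cspace n. cdist n x origin < r / K}"
  have U: "openin (ctop N) U" "origin \<in> U"
    using openin_preimage_ball[OF f0(2) L] M(2) K(1)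
    by (auto simp: U_def f0(1) origin_in_cspace)
  have V: "openin (ctop n) V" "origin \<in> V"
    using openin_ball_origin M(2) K(1)
    by (auto simp: V_def origin_in_cspace)
  have small: "cdist N x origin < r" if "x \<in> X \<inter> U" for x
  proof -
    have "cdist N x origin \<le> K * cdist n (f x) origin" using that K(2) by simp
    also have "\<dots> < r" using that K(1) by (simp add: U_def field_simps)
    finally show ?thesis .
  qed
  have "bilipschitz_on N n (X \<inter> U) (f ` X \<inter> V) f"
  proof (rule bilipschitz_onI)
    show "f ` (X \<inter> U) = f ` X \<inter> V" using X(1) f0(2) by (auto simp: U_def V_def)
    show "cdist N x y \<le> M * cdist n (f x) (f y)" if "x \<in> X \<inter> U" "y \<in> X \<inter> U" for x y
      using that small by (intro M(3)) auto
    show "cdist n (f x) (f y) \<le> L * cdist N x y" if "x \<in> X \<inter> U" "y \<in> X \<inter> U" for x y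
      using that X(1) by (intro L(2)) auto
  qed (auto simp: U_def V_def)
  then show ?thesis
    unfolding bilipschitz_germ_embedding_def using U V f0(1) algebraic_set_closedin[OF f0(3)] by blast
qed

lemma finite_germ_embedding:
  assumes "finite X" "X \<subseteq> cspace N" "origin \<in> X"
  shows "bilipschitz_germ_embedding N X 0 (\<lambda>_. origin) (cspace 0)"
proof -
  have zero: "cspace 0 = {origin}" by (auto simp: cspace_def)
  \<comment> \<open>The entry 1 keeps S nonempty when X consists of the origin alone.\<close>
  define S where "S = insert 1 ((\<lambda>x. cdist N x origin) ` (X - {origin}))"
  have S: "finite S" "S \<noteq> {}" using assms(1) by (auto simp: S_def)
  define r where "r = Min S"
  have "\<forall>s\<in>S. s > 0"
    using assms(2) cdist_eq_0_iff[of _ N origin] cdist_nonneg[of N]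
    by (auto simp: S_def order_less_le origin_in_cspace subset_iff)
  then have r: "r > 0" using S by (simp add: r_def)
  define U where "U = {x \<in> cspace N. cdist N x origin < r}"
  have only: "x = origin" if "x \<in> X" "x \<in> U" for x
  proof (rule ccontr)
    assume "x \<noteq> origin"
    then have "cdist N x origin \<in> S" using that by (auto simp: S_def)
    then have "r \<le> cdist N x origin" using S(1) by (simp add: r_def)
    then show False using that(2) by (simp add: U_def)
  qed
  have U: "openin (ctop N) U" "origin \<in> U"
    using openin_ball_origin r
    by (auto simp: U_def origin_in_cspace)
  have XU: "X \<inter> U = {origin}"
  proof
    show "X \<inter> U \<subseteq> {origin}" by (intro subsetI, unfold singleton_iff, rule only) simp_all
  qed (use U(2) assms(3) in simp)
  have "bilipschitz_on N 0 (X \<inter> U) (cspace 0 \<inter> cspace 0) (\<lambda>_. origin)"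
    unfolding XU by (rule bilipschitz_onI[where L = 0 and K = 0])
      (auto simp: zero origin_in_cspace)
  then show ?thesis
    unfolding bilipschitz_germ_embedding_def
    using U openin_ctop_cspace[of 0] origin_in_cspace[of 0]
      algebraic_set_closedin[OF algebraic_set_cspace[of 0 0]] by blast
qed

theorem theorem5p5:
  fixes N k :: nat and X :: "(nat \<Rightarrow> complex) set"
  assumes "algebraic_set N X"
    and "origin \<in> X"
    and "algebraic_dim N X = enat k"
  shows "\<exists>f Y A. bilipschitz_germ_embedding N X (2 * k) f Y \<and>
                 regular_map_germ N X (2 * k) f \<and>
                 algebraic_set (2 * k) A \<and> same_germ (2 * k) Y A"
proof -
  have X: "X \<subseteq> cspace N" using assms(1) by (rule algebraic_set_subset)
  obtain m g where g: "finite_map N X m g" "g ` X = cspace m" "growth N X m"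
    using Noether_normalization[OF assms(1)] assms(2) by blast
  have mk: "m \<le> k" using algebraic_dim_ge[OF g(1) assms(1) g(2)] assms(3) by simp
  show ?thesis
  proof (cases "k = 0")
    case True
    have "cspace 0 = {origin}" by (auto simp: cspace_def)
    \<comment> \<open>For k = 0 also m = 0, so X is a single fibre of g.\<close>
    then have "X = {x \<in> X. g x = origin}" using g(2) mk True by auto
    also have "finite \<dots>" using g(1) by (simp add: finite_map_def)
    finally have "bilipschitz_germ_embedding N X (2 * k) (\<lambda>_. origin) (cspace (2 * k))"
      using finite_germ_embedding[OF _ X assms(2)] True by simp
    moreover have "regular_map_germ N X (2 * k) (\<lambda>_. origin)"
      using assms(2) by (intro regular_map_germ_polynomial) (auto simp: origin_in_cspace intro: cpoly.const)
    ultimately show ?thesis using algebraic_set_cspace[of "2 * k" "2 * k"] same_germ_refl by blast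
  next
    case False
    then obtain f where f: "good_projection N X (2 * k) f"
      using ex_good_projection[OF assms(1,2) growth_mono[OF g(3) mk]] by auto
    have "regular_map_germ N X (2 * k) f"
      using f X assms(2) by (intro regular_map_germ_polynomial) (auto simp: good_projection_def)
    moreover have "algebraic_set (2 * k) (f ` X)" using f by (simp only: good_projection_def)
    ultimately show ?thesis
      using good_projection_germ_embedding[OF f X assms(2)] same_germ_refl by blast
  qed
qed

end
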